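(* Let $f$ be a symmetric function. The operator $\overline{K}_f$ lies in the subalgebra of $\operatorname{End}(\mathrm{Sym})$ generated by the operators $U_g$ and $D_g$ for $g\in\mathrm{Sym}$. More precisely, \[ \overline{K}_{f} = \sum_{\lambda} U_{f[X-1] \ast s_{\lambda}}\, D_{s_\lambda}, \] where the sum is over all partitions $\lambda$.
   Context: $\mathrm{Sym}=\mathrm{Sym}(X)$ is the algebra of symmetric functions over $\mathbb{Q}$, with Schur basis $(s_\lambda)$, power sums $p_k$ and $p_\lambda$, complete homogeneous functions $h_n$ ($h_0=1$, $h_n=0$ for $n<0$), and the Hall inner product (Schur functions orthonormal). The Kronecker product $\ast$ is the bilinear product on $\mathrm{Sym}$ with $p_\lambda\ast p_\mu=\delta_{\lambda\mu}z_\lambda p_\lambda$, where $z_\lambda=\prod_i i^{m_i}m_i!$ and $m_i$ is the number of parts of $\lambda$ equal to $i$ (so products of homogeneous elements of different degrees vanish). $f\mapsto f[X-1]$ is the algebra endomorphism of $\mathrm{Sym}$ with $p_k\mapsto p_k-1$ for all $k\ge1$. For $f\in\mathrm{Sym}$: $U_f(g)=fg$ and $D_f$ is the adjoint of $U_f$ for the Hall inner product. For a partition $\lambda$ and $g$ homogeneous of degree $n$, $\overline{K}_\lambda(g)=s_{(n-|\lambda|,\lambda_1,\lambda_2,\ldots)}\ast g$, extended linearly in $g$, where for any integer sequence $s_{(\alpha_1,\ldots,\alpha_N)}=\det(h_{\alpha_i+j-i})_{i,j=1,\ldots,N}$ (Jacobi--Trudi); $\overline{K}_f$ is defined for all $f\in\mathrm{Sym}$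 by linearity from $\overline{K}_{s_\lambda}=\overline{K}_\lambda$. *)

theory Defs
  imports
    Jordan_Normal_Form.Determinant
    "HOL-Library.Multiset"
begin

section \<open>The ring of symmetric functions over the rationals\<close>

text \<open>
  A symmetric function is a formal power series of bounded degree in the variables
  \<open>x\<^sub>0, x\<^sub>1, x\<^sub>2, \<dots>\<close> with rational coefficients that is invariant under all permutations
  of the variables.  The monomial \<open>x\<^sub>i x\<^sub>j \<cdots>\<close> is encoded as the multiset \<open>{#i, j, \<dots>#}\<close> of its
  variable indices, and a power series is its coefficient function.
\<close>

typedef sym =
  "{F :: nat multiset \<Rightarrow> rat.
     (\<forall>\<sigma> M. bij \<sigma> \<longrightarrow> F (image_mset \<sigma> M) = F M) \<and>
     (\<exists>d. \<forall>M. size M > d \<longrightarrow> F M = 0)}"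
  morphisms coeff_sym Abs_sym
  by (rule exI[of _ "\<lambda>_. 0"]) auto

setup_lifting type_definition_sym

text \<open>The Cauchy product of power series: the sum over all factorisations of a monomial.\<close>

definition cauchy :: "(nat multiset \<Rightarrow> rat) \<Rightarrow> (nat multiset \<Rightarrow> rat) \<Rightarrow> nat multiset \<Rightarrow> rat" where
  "cauchy F G M = (\<Sum>(A, B) | A + B = M. F A * G B)"

lemma finite_mset_splits: "finite {(A, B). A + B = (M :: 'a multiset)}"
proof (induction M)
  case empty
  have "{(A, B). A + B = ({#} :: 'a multiset)} = {({#}, {#})}" by auto
  then show ?case by simp
next
  case (add x M)
  let ?S = "{(A, B). A + B = M}"
  have "{(A, B). A + B = add_mset x M} \<subseteq>
      (\<lambda>(A, B). (add_mset x A, B)) ` ?S \<union> (\<lambda>(A, B). (A, add_mset x B)) ` ?S"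
  proof safe
    fix A B assume AB: "A + B = add_mset x M"
      and no: "(A, B) \<notin> (\<lambda>(A, B). (A, add_mset x B)) ` ?S"
    from AB have "x \<in># A \<or> x \<in># B" by (metis union_iff union_single_eq_member)
    then show "(A, B) \<in> (\<lambda>(A, B). (add_mset x A, B)) ` ?S"
    proof
      assume "x \<in># A"
      then obtain A' where A: "A = add_mset x A'" by (metis mset_add)
      with AB have "(A', B) \<in> ?S" by simp
      with A show ?thesis by force
    next
      assume "x \<in># B"
      then obtain B' where B: "B = add_mset x B'" by (metis mset_add)
      with AB have "(A, B') \<in> ?S" by simp
      with B no show ?thesis by force
    qed
  qed
  then show ?case by (rule finite_subset) (simp add: add)
qed

lemma cauchy_commute: "cauchy F G = cauchy G F"
proof
  fix M
  show "cauchy F G M = cauchy G F M"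
    unfolding cauchy_def
    by (rule sum.reindex_bij_witness[of _ prod.swap prod.swap]) (auto simp: add.commute mult.commute)
qed

lemma cauchy_one: "cauchy (\<lambda>M. if M = {#} then 1 else 0) G = G"
proof
  fix M
  let ?h = "\<lambda>p :: nat multiset \<times> nat multiset. (if fst p = {#} then 1 else 0) * G (snd p)"
  have "(\<Sum>p | fst p + snd p = M. ?h p) = (\<Sum>p \<in> {({#} :: nat multiset, M)}. ?h p)"
    using finite_mset_splits[of M]
    by (intro sum.mono_neutral_right) (auto simp: case_prod_unfold)
  then show "cauchy (\<lambda>M. if M = {#} then 1 else 0) G M = G M"
    by (simp add: cauchy_def case_prod_unfold)
qed

lemma cauchy_assoc: "cauchy (cauchy F G) H = cauchy F (cauchy G H)"
proof
  fix M :: "nat multiset"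
  let ?L = "SIGMA p:{(A, B). A + B = M}. {(C, D). C + D = fst p}"
  let ?R = "SIGMA p:{(A, B). A + B = M}. {(C, D). C + D = snd p}"
  have "cauchy (cauchy F G) H M =
      (\<Sum>p | fst p + snd p = M. \<Sum>q | fst q + snd q = fst p. F (fst q) * G (snd q) * H (snd p))"
    unfolding cauchy_def by (simp add: case_prod_unfold sum_distrib_right)
  also have "\<dots> = (\<Sum>(p, q) \<in> ?L. F (fst q) * G (snd q) * H (snd p))"
    using finite_mset_splits by (subst sum.Sigma) (auto simp: case_prod_unfold)
  also have "\<dots> = (\<Sum>(p, q) \<in> ?R. F (fst p) * (G (fst q) * H (snd q)))"
    by (rule sum.reindex_bij_witness
        [of _ "\<lambda>(p, q). ((fst p + fst q, snd q), (fst p, fst q))"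
              "\<lambda>(p, q). ((fst q, snd q + snd p), (snd q, snd p))"])
       (auto simp: add.assoc mult.assoc)
  also have "\<dots> =
      (\<Sum>p | fst p + snd p = M. \<Sum>q | fst q + snd q = snd p. F (fst p) * (G (fst q) * H (snd q)))"
    using finite_mset_splits by (subst sum.Sigma) (auto simp: case_prod_unfold)
  also have "\<dots> = cauchy F (cauchy G H) M"
    unfolding cauchy_def by (simp add: case_prod_unfold sum_distrib_left)
  finally show "cauchy (cauchy F G) H M = cauchy F (cauchy G H) M" .
qed

lemma cauchy_symmetric:
  assumes F: "\<And>\<sigma> M. bij \<sigma> \<Longrightarrow> F (image_mset \<sigma> M) = F M"
    and G: "\<And>\<sigma> M. bij \<sigma> \<Longrightarrow> G (image_mset \<sigma> M) = G M"
    and \<sigma>: "bij \<sigma>"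
  shows "cauchy F G (image_mset \<sigma> M) = cauchy F G M"
proof -
  have [simp]: "inv_into UNIV \<sigma> \<circ> \<sigma> = id" "\<sigma> \<circ> inv_into UNIV \<sigma> = id"
    using \<sigma> by (auto simp: fun_eq_iff bij_is_inj bij_is_surj surj_f_inv_f)
  have inv: "image_mset (inv_into UNIV \<sigma>) (image_mset \<sigma> A) = A"
    "image_mset \<sigma> (image_mset (inv_into UNIV \<sigma>) A) = A" for A
    by (simp_all add: multiset.map_comp multiset.map_id)
  show ?thesis
    unfolding cauchy_def
    by (rule sum.reindex_bij_witness
        [of _ "\<lambda>(A, B). (image_mset \<sigma> A, image_mset \<sigma> B)"
              "\<lambda>(A, B). (image_mset (inv_into UNIV \<sigma>) A, image_mset (inv_into UNIV \<sigma>) B)"])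
       (auto simp: inv F G \<sigma> bij_imp_bij_inv simp flip: image_mset_union)
qed

lemma cauchy_bounded:
  assumes "\<forall>M. size M > d \<longrightarrow> F M = 0" "\<forall>M. size M > e \<longrightarrow> G M = 0" "size M > d + e"
  shows "cauchy F G M = 0"
  unfolding cauchy_def
proof (rule sum.neutral, clarify)
  fix A B assume "M = A + B"
  with assms(3) have "size A > d \<or> size B > e" by auto
  with assms show "F A * G B = 0" by auto
qed

instantiation sym :: comm_ring_1
begin

lift_definition zero_sym :: sym is "\<lambda>_. 0" by auto

lift_definition one_sym :: sym is "\<lambda>M. if M = {#} then 1 else 0"
  by (auto intro!: exI[of _ 0])

lift_definition plus_sym :: "sym \<Rightarrow> sym \<Rightarrow> sym" is "\<lambda>F G M. F M + G M"
proof -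
  fix F G :: "nat multiset \<Rightarrow> rat"
  assume F: "(\<forall>\<sigma> M. bij \<sigma> \<longrightarrow> F (image_mset \<sigma> M) = F M) \<and> (\<exists>d. \<forall>M. size M > d \<longrightarrow> F M = 0)"
    and G: "(\<forall>\<sigma> M. bij \<sigma> \<longrightarrow> G (image_mset \<sigma> M) = G M) \<and> (\<exists>d. \<forall>M. size M > d \<longrightarrow> G M = 0)"
  then obtain d e where "\<forall>M. size M > d \<longrightarrow> F M = 0" "\<forall>M. size M > e \<longrightarrow> G M = 0" by blast
  then have "\<forall>M. size M > max d e \<longrightarrow> F M + G M = 0" by simp
  with F G show "(\<forall>\<sigma> M. bij \<sigma> \<longrightarrow> F (image_mset \<sigma> M) + G (image_mset \<sigma> M) = F M + G M) \<and>
      (\<exists>d. \<forall>M. size M > d \<longrightarrow> F M + G M = 0)" by (metis (no_types, lifting))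
qed

lift_definition uminus_sym :: "sym \<Rightarrow> sym" is "\<lambda>F M. - F M" by auto

definition minus_sym :: "sym \<Rightarrow> sym \<Rightarrow> sym" where "minus_sym f g = f + - g"

lift_definition times_sym :: "sym \<Rightarrow> sym \<Rightarrow> sym" is cauchy
proof -
  fix F G :: "nat multiset \<Rightarrow> rat"
  assume F: "(\<forall>\<sigma> M. bij \<sigma> \<longrightarrow> F (image_mset \<sigma> M) = F M) \<and> (\<exists>d. \<forall>M. size M > d \<longrightarrow> F M = 0)"
    and G: "(\<forall>\<sigma> M. bij \<sigma> \<longrightarrow> G (image_mset \<sigma> M) = G M) \<and> (\<exists>d. \<forall>M. size M > d \<longrightarrow> G M = 0)"
  then obtain d e where "\<forall>M. size M > d \<longrightarrow> F M = 0" "\<forall>M. size M > e \<longrightarrow> G M = 0" by blast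
  then have "\<forall>M. size M > d + e \<longrightarrow> cauchy F G M = 0" using cauchy_bounded by blast
  moreover have "\<forall>\<sigma> M. bij \<sigma> \<longrightarrow> cauchy F G (image_mset \<sigma> M) = cauchy F G M"
    using F G by (auto intro: cauchy_symmetric)
  ultimately show "(\<forall>\<sigma> M. bij \<sigma> \<longrightarrow> cauchy F G (image_mset \<sigma> M) = cauchy F G M) \<and>
      (\<exists>d. \<forall>M. size M > d \<longrightarrow> cauchy F G M = 0)" by blast
qed

instance
proof
  fix a b c :: sym
  show "a * b * c = a * (b * c)" by transfer (rule cauchy_assoc)
  show "a * b = b * a" by transfer (rule cauchy_commute)
  show "1 * a = a" by transfer (rule cauchy_one)
  show "(a + b) * c = a * c + b * c"
    by transfer
       (auto simp: cauchy_def fun_eq_iff sum.distrib[symmetric] case_prod_unfold algebra_simps)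
  show "a + b + c = a + (b + c)" by transfer (simp add: add.assoc)
  show "a + b = b + a" by transfer (simp add: add.commute)
  show "0 + a = a" by transfer simp
  show "- a + a = 0" by transfer simp
  show "a - b = a + - b" by (rule minus_sym_def)
  show "(0 :: sym) \<noteq> 1" by transfer (auto simp: fun_eq_iff)
qed

end

lift_definition scale_sym :: "rat \<Rightarrow> sym \<Rightarrow> sym" is "\<lambda>c F M. c * F M" by auto

global_interpretation sym: vector_space scale_sym
  by standard (transfer; simp add: algebra_simps)+

text \<open>The homogeneous component of degree \<open>n\<close>.\<close>

lift_definition hom_component :: "nat \<Rightarrow> sym \<Rightarrow> sym" is
  "\<lambda>n F M. if size M = n then F M else 0"
  by auto

section \<open>Partitions and the classical families\<close>

definition is_partition :: "nat list \<Rightarrow> bool" where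
  "is_partition \<mu> \<longleftrightarrow> sorted_wrt (\<ge>) \<mu> \<and> 0 \<notin> set \<mu>"

definition zee :: "nat list \<Rightarrow> nat" where
  "zee \<mu> = (\<Prod>i \<in> set \<mu>. i ^ count_list \<mu> i * fact (count_list \<mu> i))"

text \<open>The power sum \<open>\<Sum>\<^sub>i x\<^sub>i\<^sup>k\<close>.  It is only used for \<open>k \<ge> 1\<close>.\<close>

lift_definition power_sum :: "nat \<Rightarrow> sym" is
  "\<lambda>k M. if \<exists>i. M = replicate_mset k i then 1 else 0"
proof (intro conjI allI impI)
  fix k :: nat and \<sigma> :: "nat \<Rightarrow> nat" and M :: "nat multiset"
  assume \<sigma>: "bij \<sigma>"
  have "(\<exists>i. image_mset \<sigma> M = replicate_mset k i) \<longleftrightarrow> (\<exists>i. M = replicate_mset k i)"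
  proof
    assume "\<exists>i. image_mset \<sigma> M = replicate_mset k i"
    then obtain i where "image_mset \<sigma> M = replicate_mset k i" ..
    then have "image_mset (inv_into UNIV \<sigma>) (image_mset \<sigma> M) = replicate_mset k (inv_into UNIV \<sigma> i)" by simp
    then show "\<exists>i. M = replicate_mset k i"
      using \<sigma> by (auto simp: multiset.map_comp bij_is_inj inv_o_cancel)
  qed auto
  then show "(if \<exists>i. image_mset \<sigma> M = replicate_mset k i then 1 else 0 :: rat) =
      (if \<exists>i. M = replicate_mset k i then 1 else 0)" by simp
next
  fix k :: nat
  show "\<exists>d. \<forall>M :: nat multiset. size M > d \<longrightarrow>
      (if \<exists>i. M = replicate_mset k i then 1 else 0 :: rat) = 0"
    by (intro exI[of _ k]) auto
qed

definition power_sums :: "nat list \<Rightarrow> sym" where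
  "power_sums \<mu> = prod_list (map power_sum \<mu>)"

text \<open>The sum of all monomials of degree \<open>n\<close>, for an integer \<open>n\<close>; it is \<open>0\<close> for \<open>n < 0\<close>.\<close>

lift_definition complete_hom :: "int \<Rightarrow> sym" is
  "\<lambda>n M. if int (size M) = n then 1 else 0"
proof (intro conjI allI impI)
  fix n :: int
  show "\<exists>d. \<forall>M :: nat multiset. size M > d \<longrightarrow> (if int (size M) = n then 1 else 0 :: rat) = 0"
    by (intro exI[of _ "nat n"]) auto
qed auto

definition schur :: "int list \<Rightarrow> sym" where
  "schur \<alpha> = det (mat (length \<alpha>) (length \<alpha>)
     (\<lambda>(i, j). complete_hom (\<alpha> ! i + int j - int i)))"

abbreviation schur_part :: "nat list \<Rightarrow> sym" where
  "schur_part \<mu> \<equiv> schur (map int \<mu>)"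

section \<open>Hall inner product, Kronecker product and the substitution $X - 1$\<close>

text \<open>
  The Schur functions and the products of power sums are bases of the space of symmetric functions,
  and the power sums generate the algebra freely; so each definite description below has exactly
  one solution.
\<close>

definition hall :: "sym \<Rightarrow> sym \<Rightarrow> rat" where
  "hall = (THE B.
     (\<forall>f. Vector_Spaces.linear scale_sym (*) (B f)) \<and>
     (\<forall>g. Vector_Spaces.linear scale_sym (*) (\<lambda>f. B f g)) \<and>
     (\<forall>\<mu> \<nu>. is_partition \<mu> \<longrightarrow> is_partition \<nu> \<longrightarrow>
        B (schur_part \<mu>) (schur_part \<nu>) = (if \<mu> = \<nu> then 1 else 0)))"

definition kronecker :: "sym \<Rightarrow> sym \<Rightarrow> sym" where
  "kronecker = (THE B.
     (\<forall>f. Vector_Spaces.linear scale_sym scale_sym (B f)) \<and>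
     (\<forall>g. Vector_Spaces.linear scale_sym scale_sym (\<lambda>f. B f g)) \<and>
     (\<forall>\<mu> \<nu>. is_partition \<mu> \<longrightarrow> is_partition \<nu> \<longrightarrow>
        B (power_sums \<mu>) (power_sums \<nu>) =
          (if \<mu> = \<nu> then scale_sym (of_nat (zee \<mu>)) (power_sums \<mu>) else 0)))"

definition subst_minus_one :: "sym \<Rightarrow> sym" where
  "subst_minus_one = (THE \<phi>.
     Vector_Spaces.linear scale_sym scale_sym \<phi> \<and>
     \<phi> 1 = 1 \<and> (\<forall>f g. \<phi> (f * g) = \<phi> f * \<phi> g) \<and>
     (\<forall>k \<ge> 1. \<phi> (power_sum k) = power_sum k - 1))"

section \<open>Operators on symmetric functions\<close>

definition U_op :: "sym \<Rightarrow> sym \<Rightarrow> sym" where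
  "U_op f g = f * g"

definition D_op :: "sym \<Rightarrow> sym \<Rightarrow> sym" where
  "D_op f = (THE D. \<forall>g h. hall (D g) h = hall g (U_op f h))"

text \<open>
  On homogeneous \<open>g\<close> of degree \<open>n\<close> this is \<open>s\<^bsub>(n - |\<mu>|, \<mu>)\<^esub> * g\<close>; a general \<open>g\<close> is split
  into its finitely many nonzero homogeneous components.
\<close>

definition Kbar_part :: "nat list \<Rightarrow> sym \<Rightarrow> sym" where
  "Kbar_part \<mu> g = (\<Sum>n | hom_component n g \<noteq> 0.
     kronecker (schur ((int n - int (sum_list \<mu>)) # map int \<mu>)) (hom_component n g))"

definition Kbar :: "sym \<Rightarrow> sym \<Rightarrow> sym" where
  "Kbar = (THE K.
     (\<forall>g. Vector_Spaces.linear scale_sym scale_sym (\<lambda>f. K f g)) \<and>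
     (\<forall>\<mu>. is_partition \<mu> \<longrightarrow> K (schur_part \<mu>) = Kbar_part \<mu>))"

text \<open>The unital subalgebra of the endomorphism algebra generated by a set of operators.\<close>

inductive_set op_subalgebra :: "(sym \<Rightarrow> sym) set \<Rightarrow> (sym \<Rightarrow> sym) set"
  for G :: "(sym \<Rightarrow> sym) set" where
  gen: "T \<in> G \<Longrightarrow> T \<in> op_subalgebra G"
| ident: "(\<lambda>g. g) \<in> op_subalgebra G"
| add: "S \<in> op_subalgebra G \<Longrightarrow> T \<in> op_subalgebra G \<Longrightarrow> (\<lambda>g. S g + T g) \<in> op_subalgebra G"
| scale: "T \<in> op_subalgebra G \<Longrightarrow> (\<lambda>g. scale_sym c (T g)) \<in> op_subalgebra G"
| comp: "S \<in> op_subalgebra G \<Longrightarrow> T \<in> op_subalgebra G \<Longrightarrow> S \<circ> T \<in> op_subalgebra G"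

text \<open>The term indexed by \<open>\<mu>\<close> in the expansion of \<open>Kbar f\<close>.\<close>

definition UD_term :: "sym \<Rightarrow> nat list \<Rightarrow> sym \<Rightarrow> sym" where
  "UD_term f \<mu> = U_op (kronecker (subst_minus_one f) (schur_part \<mu>)) \<circ> D_op (schur_part \<mu>)"

end

theory Submission
  imports Defs "HOL-Computational_Algebra.Polynomial_FPS"
begin

text \<open>
  Both sides of the expansion are diagonal operators in the basis of products of power sums
  \<open>p\<^sub>L\<close>, and the proof computes their eigenvalues.  Put \<open>F = f[X - 1]\<close>.

  The sum \<open>\<Sum>\<^sub>\<lambda> U\<^bsub>F * s\<^sub>\<lambda>\<^esub> D\<^bsub>s\<^sub>\<lambda>\<^esub>\<close> is linear in \<open>F\<close>, so let \<open>F = p\<^sub>K\<close>.  Kronecker multiplication by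
  any \<open>g\<close> is diagonal, \<open>g * p\<^sub>K = \<langle>g, p\<^sub>K\<rangle> p\<^sub>K\<close>, so the coefficients are \<open>\<langle>s\<^sub>\<lambda>, p\<^sub>K\<rangle> p\<^sub>K\<close>.  Since the Schur
  functions are orthonormal, the sum collapses to \<open>U\<^sub>F D\<^sub>F\<close>, which multiplies \<open>p\<^sub>L\<close> by
  \<open>z\<^sub>L / z\<^bsub>L - K\<^esub>\<close> if \<open>K \<subseteq> L\<close> and by \<open>0\<close> otherwise (\<open>sum_UD_psum\<close>).

  The operator belonging to \<open>s\<^sub>\<mu>\<close> multiplies \<open>p\<^sub>L\<close>, of degree \<open>n\<close>, by \<open>\<langle>s\<^bsub>(n - |\<mu>|, \<mu>)\<^esub>, p\<^sub>L\<rangle>\<close>.  Because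
  \<open>h\<^sub>m[X - 1] = h\<^sub>m - h\<^sub>m\<^sub>-\<^sub>1\<close>, the function \<open>s\<^sub>\<mu>[X - 1]\<close> is the Jacobi-Trudi determinant of
  \<open>(n - |\<mu>|, \<mu>)\<close> with its first row replaced by ones.  Each \<open>h\<^sub>m\<close> pairs to \<open>1\<close> with
  every product of power sums of degree \<open>m\<close>, so restoring the first row and pairing with \<open>p\<^sub>L\<close>
  gives the same linear functional of \<open>s\<^sub>\<mu>[X - 1]\<close> as above (\<open>inner_schur_Cons_psum\<close>).

  This rests on the classical structure of the ring, which also shows that the definite
  descriptions of the Hall and Kronecker products, of the substitution and of the operators have
  solutions.  The products of power sums form a basis since their matrix over the monomials is
  triangular (\<open>independent_psum\<close>, \<open>span_psum\<close>), so a form can be defined by making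
  them orthogonal.  For this form the adjoint of multiplication by \<open>p\<^sub>k\<close> is a derivation
  that lowers the index of each \<open>h\<^sub>m\<close> by \<open>k\<close>, whence products of complete homogeneous functions
  extract coefficients of monomials (\<open>inner_prod_complete_hom\<close>).  Pairing with a Schur function is
  thus reading a coefficient of the product with a Vandermonde determinant, and Jacobi's
  bialternant formula gives orthonormality (\<open>bialternant\<close>, \<open>inner_schur_part\<close>).  Counting
  partitions then shows that the Schur functions span.
\<close>

section \<open>Products of power sums form a basis\<close>

definition psum :: "nat multiset \<Rightarrow> sym" where
  "psum K = (\<Prod>k\<in>#K. power_sum k)"

lemma psum_empty [simp]: "psum {#} = 1"
  and psum_add [simp]: "psum (add_mset k K) = power_sum k * psum K"
  and psum_union: "psum (K + L) = psum K * psum L"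
  by (simp_all add: psum_def)

lemma coeff_sym_scale [simp]: "coeff_sym (scale_sym c f) M = c * coeff_sym f M"
  and coeff_sym_add [simp]: "coeff_sym (f + g) M = coeff_sym f M + coeff_sym g M"
  and coeff_sym_zero [simp]: "coeff_sym 0 M = 0"
  and coeff_sym_one: "coeff_sym 1 M = (if M = {#} then 1 else 0)"
  and coeff_sym_uminus [simp]: "coeff_sym (- f) M = - coeff_sym f M"
  by (simp_all add: scale_sym.rep_eq plus_sym.rep_eq zero_sym.rep_eq one_sym.rep_eq uminus_sym.rep_eq)

lemma coeff_sym_diff [simp]: "coeff_sym (f - g) M = coeff_sym f M - coeff_sym g M"
  unfolding minus_sym_def coeff_sym_add coeff_sym_uminus by simp

lemma coeff_sym_sum [simp]: "coeff_sym (sum f A) M = (\<Sum>x\<in>A. coeff_sym (f x) M)"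
  by (induction A rule: infinite_finite_induct) auto

lemma coeff_sym_mult: "coeff_sym (f * g) M = (\<Sum>(A, B) | A + B = M. coeff_sym f A * coeff_sym g B)"
  by (simp add: times_sym.rep_eq cauchy_def)

lemma coeff_sym_power_sum:
  "coeff_sym (power_sum k) M = (if \<exists>i. M = replicate_mset k i then 1 else 0)"
  by (simp add: power_sum.rep_eq)

lemma sym_eqI: "(\<And>M. coeff_sym f M = coeff_sym g M) \<Longrightarrow> f = g"
  by (simp add: coeff_sym_inject[symmetric] fun_eq_iff)

lemma coeff_sym_bij: "bij \<sigma> \<Longrightarrow> coeff_sym f (image_mset \<sigma> M) = coeff_sym f M"
  using coeff_sym[of f] by blast

lemma coeff_sym_bounded: obtains d where "\<And>M. size M > d \<Longrightarrow> coeff_sym f M = 0"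
  using coeff_sym[of f] by blast

text \<open>The exponents of a monomial, as a multiset: this is the orbit invariant of the monomial.\<close>

definition exponents :: "nat multiset \<Rightarrow> nat multiset" where
  "exponents M = image_mset (count M) (mset_set (set_mset M))"

lemma exponents_empty [simp]: "exponents {#} = {#}"
  by (simp add: exponents_def)

lemma zero_notin_exponents [simp]: "0 \<notin># exponents M"
  by (auto simp: exponents_def count_eq_zero_iff)

lemma size_exponents [simp]: "size (exponents M) = card (set_mset M)"
  by (simp add: exponents_def)

lemma sum_exponents [simp]: "\<Sum>\<^sub># (exponents M) = size M"
  by (simp add: exponents_def size_multiset_overloaded_eq sum_unfold_sum_mset)

lemma exponents_replicate_plus:
  assumes "k > 0" "x \<notin># M"
  shows "exponents (replicate_mset k x + M) = add_mset k (exponents M)"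
proof -
  have "image_mset (count (replicate_mset k x + M)) (mset_set (set_mset M)) =
      image_mset (count M) (mset_set (set_mset M))"
    using assms by (intro image_mset_cong) (auto simp: count_eq_zero_iff)
  moreover have "set_mset (replicate_mset k x + M) = insert x (set_mset M)"
    using assms by (auto simp: set_mset_replicate_mset_subset)
  ultimately show ?thesis using assms by (simp add: exponents_def count_eq_zero_iff)
qed

lemma add_mset_exponentsE:
  assumes "exponents M = add_mset k K"
  obtains x N where "M = replicate_mset k x + N" "x \<notin># N" "exponents N = K" "k > 0"
proof -
  have "k \<in># exponents M" using assms by simp
  then obtain x where x: "x \<in># M" "k = count M x"
    by (auto simp: exponents_def)
  define N where "N = M - replicate_mset k x"
  have sub: "replicate_mset k x \<subseteq># M" using x by (simp add: count_le_replicate_mset_subset_eq[symmetric])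
  have 1: "M = replicate_mset k x + N" using sub by (simp add: N_def)
  have 2: "x \<notin># N" by (simp add: N_def x(2) not_in_iff)
  have 3: "k > 0" using x by simp
  have "exponents N = K" using assms exponents_replicate_plus[OF 3 2] 1 by simp
  with 1 2 3 that show ?thesis by blast
qed

text \<open>
  Two monomials with the same exponents are related by a permutation of the variables.  Building
  the permutation one variable at a time, by composing with a transposition, gives a bijection of
  all variables at once, not only of those that occur.
\<close>

lemma exponents_eq_imp_bij:
  "exponents M = exponents N \<Longrightarrow> \<exists>\<sigma>. bij \<sigma> \<and> image_mset \<sigma> M = N"
proof (induction "exponents M" arbitrary: M N)
  case empty
  then have "size M = 0" "size N = 0" by (metis sum_exponents sum_mset.empty)+
  then show ?case by (auto intro!: exI[of _ id])
next
  case (add k K)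
  obtain x M' where M: "M = replicate_mset k x + M'" "x \<notin># M'" "exponents M' = K"
    using add_mset_exponentsE[OF add(2)[symmetric]] by metis
  obtain y N' where N: "N = replicate_mset k y + N'" "y \<notin># N'" "exponents N' = K"
    using add_mset_exponentsE[of N k K] add(2,3) by metis
  from add(1)[of M' N'] M(3) N(3) obtain \<sigma> where \<sigma>: "bij \<sigma>" "image_mset \<sigma> M' = N'" by auto
  let ?\<tau> = "Transposition.transpose (\<sigma> x) y"
  have "image_mset (?\<tau> \<circ> \<sigma>) M' = image_mset \<sigma> M'"
  proof (intro image_mset_cong)
    fix z assume z: "z \<in># M'"
    then have "\<sigma> z \<noteq> \<sigma> x" using M(2) \<sigma>(1) by (metis bij_pointE)
    moreover have "\<sigma> z \<noteq> y" using z \<sigma>(2) N(2) by (metis imageI set_image_mset)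
    ultimately show "(?\<tau> \<circ> \<sigma>) z = \<sigma> z" by (simp add: Transposition.transpose_def)
  qed
  then have "image_mset (?\<tau> \<circ> \<sigma>) M = N"
    using \<sigma> by (simp add: M(1) N(1) del: image_mset.compositionality)
  moreover have "bij (?\<tau> \<circ> \<sigma>)" using \<sigma> by (simp add: bij_comp)
  ultimately show ?case by blast
qed

lemma coeff_sym_eq_exponents: "exponents M = exponents N \<Longrightarrow> coeff_sym f M = coeff_sym f N"
  using exponents_eq_imp_bij coeff_sym_bij by metis

lemma exists_exponents: "0 \<notin># K \<Longrightarrow> \<exists>M. exponents M = K"
proof (induction K)
  case (add k K)
  then obtain M where M: "exponents M = K" by auto
  obtain x where "x \<notin># M" using ex_new_if_finite[of "set_mset M"] by auto
  with M add exponents_replicate_plus[of k x M] show ?case by auto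
qed (auto intro: exI[of _ "{#}"])

text \<open>
  The matrix of the products of power sums in terms of monomials is triangular: a monomial of
  \<open>psum K\<close> is made from one power of a variable for each element of \<open>K\<close>, so that
  it involves at most \<open>size K\<close> variables, and exactly that many only if no two powers use the
  same variable.
\<close>

lemma coeff_psum_nonzero:
  assumes "0 \<notin># K" "coeff_sym (psum K) M \<noteq> 0"
  shows "card (set_mset M) \<le> size K \<and> (card (set_mset M) = size K \<longrightarrow> exponents M = K)"
  using assms
proof (induction K arbitrary: M)
  case empty
  then show ?case by (auto simp: coeff_sym_one split: if_splits)
next
  case (add k K)
  from add.prems(2) obtain A B where AB: "A + B = M"
    "coeff_sym (power_sum k) A \<noteq> 0" "coeff_sym (psum K) B \<noteq> 0"
    unfolding psum_add coeff_sym_mult by (auto elim!: sum.not_neutral_contains_not_neutral)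
  from AB(2) obtain x where A: "A = replicate_mset k x"
    by (auto simp: coeff_sym_power_sum split: if_splits)
  have k: "k > 0" using add.prems(1) by (cases k) auto
  have IH: "card (set_mset B) \<le> size K" "card (set_mset B) = size K \<Longrightarrow> exponents B = K"
    using add.IH[OF _ AB(3)] add.prems(1) by auto
  have set_M: "set_mset M = insert x (set_mset B)" using k A AB(1) by auto
  show ?case
  proof (cases "x \<in># B")
    case True
    then show ?thesis using IH set_M by (auto simp: insert_absorb)
  next
    case False
    with IH set_M exponents_replicate_plus[OF k False] A AB(1) show ?thesis by auto
  qed
qed

lemma coeff_psum_nonneg: "coeff_sym (psum K) M \<ge> 0"
proof (induction K arbitrary: M)
  case (add k K)
  then show ?case
    by (auto simp: coeff_sym_mult coeff_sym_power_sum intro!: sum_nonneg)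
qed (simp add: coeff_sym_one)

lemma coeff_psum_pos: "coeff_sym (psum (exponents M)) M > 0"
proof (induction "exponents M" arbitrary: M)
  case empty
  then have "size M = 0" by (metis sum_exponents sum_mset.empty)
  then show ?case by (simp add: coeff_sym_one)
next
  case (add k K)
  obtain x M' where M: "M = replicate_mset k x + M'" "exponents M' = K"
    using add_mset_exponentsE[OF add(2)[symmetric]] by metis
  have "0 < (\<Sum>(A, B) | A + B = M. coeff_sym (power_sum k) A * coeff_sym (psum K) B)"
  proof (rule sum_pos2[of _ "(replicate_mset k x, M')"])
    show "0 < (case (replicate_mset k x, M') of (A, B) \<Rightarrow>
        coeff_sym (power_sum k) A * coeff_sym (psum K) B)"
      using add(1)[of M'] M(2) by (auto simp: coeff_sym_power_sum)
  qed (use M finite_mset_splits in \<open>auto simp: coeff_sym_power_sum coeff_psum_nonneg\<close>)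
  then show ?case by (simp add: add(2)[symmetric] coeff_sym_mult)
qed

lemma inj_on_psum: "inj_on psum {K. 0 \<notin># K}"
proof (rule inj_onI)
  fix K L assume *: "K \<in> {K. 0 \<notin># K}" "L \<in> {K. 0 \<notin># K}" "psum K = psum L"
  obtain M N where MN: "exponents M = K" "exponents N = L"
    using * exists_exponents by blast
  have "coeff_sym (psum L) M \<noteq> 0" "coeff_sym (psum K) N \<noteq> 0"
    using coeff_psum_pos[of M] coeff_psum_pos[of N] MN *(3) by auto
  with coeff_psum_nonzero[of L M] coeff_psum_nonzero[of K N] * MN
  show "K = L" by (metis le_antisym mem_Collect_eq size_exponents)
qed

text \<open>
  In a linear relation, take a \<open>K\<close> of maximal size with nonzero coefficient: by triangularity no
  other term can contribute to a monomial with exponents \<open>K\<close>.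
\<close>

lemma independent_psum: "sym.independent (psum ` {K. 0 \<notin># K})"
proof -
  have False if S: "finite S" "S \<subseteq> psum ` {K. 0 \<notin># K}" "(\<Sum>v\<in>S. scale_sym (u v) v) = 0"
    and v: "v \<in> S" "u v \<noteq> 0" for S u v
  proof -
    obtain J where J: "J \<subseteq> {K. 0 \<notin># K}" "S = psum ` J" "inj_on psum J"
      using S(2) inj_on_psum by (auto elim!: subset_imageE dest: inj_on_subset)
    have finJ: "finite J" using S(1) J finite_imageD by blast
    have sum0: "(\<Sum>K\<in>J. scale_sym (u (psum K)) (psum K)) = 0"
      using S(3) J by (simp add: sum.reindex)
    let ?J = "{K \<in> J. u (psum K) \<noteq> 0}"
    have "?J \<noteq> {}" "finite ?J" using v J(2) finJ by auto
    then have "Max (size ` ?J) \<in> size ` ?J" by (intro Max_in) auto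
    then obtain K where K: "K \<in> ?J" "size K = Max (size ` ?J)" by auto
    have K_max: "size L \<le> size K" if "L \<in> ?J" for L
      unfolding K(2) using that \<open>finite ?J\<close> by (intro Max_ge) auto
    obtain M where M: "exponents M = K" using K J exists_exponents by blast
    have "u (psum L) * coeff_sym (psum L) M = 0" if L: "L \<in> J - {K}" for L
    proof (rule ccontr)
      assume "\<not> ?thesis"
      then have "L \<in> ?J" "coeff_sym (psum L) M \<noteq> 0" using L by auto
      with coeff_psum_nonzero[of L M] K_max[of L] J M L
      show False by (auto simp flip: size_exponents)
    qed
    then have "u (psum K) * coeff_sym (psum K) M = coeff_sym (\<Sum>K\<in>J. scale_sym (u (psum K)) (psum K)) M"
      using K finJ sum.mono_neutral_right[of J "{K}" "\<lambda>L. u (psum L) * coeff_sym (psum L) M"] by auto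
    then show False using sum0 K coeff_psum_pos[of M] M by auto
  qed
  then show ?thesis unfolding sym.dependent_explicit by blast
qed

text \<open>Homogeneity is indexed by integers so that \<open>complete_hom n\<close> is of degree \<open>n\<close> also for \<open>n < 0\<close>.\<close>

definition homogeneous :: "int \<Rightarrow> sym \<Rightarrow> bool" where
  "homogeneous n f \<longleftrightarrow> (\<forall>M. int (size M) \<noteq> n \<longrightarrow> coeff_sym f M = 0)"

lemma homogeneous_mult:
  assumes "homogeneous m f" "homogeneous n g"
  shows "homogeneous (m + n) (f * g)"
  unfolding homogeneous_def
proof (intro allI impI)
  fix M :: "nat multiset" assume M: "int (size M) \<noteq> m + n"
  show "coeff_sym (f * g) M = 0"
    unfolding coeff_sym_mult
  proof (rule sum.neutral, clarify)
    fix A B assume "M = A + B"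
    then have "int (size A) \<noteq> m \<or> int (size B) \<noteq> n" using M by auto
    then show "coeff_sym f A * coeff_sym g B = 0" using assms by (auto simp: homogeneous_def)
  qed
qed

lemma homogeneous_zero [simp]: "homogeneous n 0"
  and homogeneous_one [simp]: "homogeneous 0 1"
  and homogeneous_add: "homogeneous n f \<Longrightarrow> homogeneous n g \<Longrightarrow> homogeneous n (f + g)"
  and homogeneous_diff: "homogeneous n f \<Longrightarrow> homogeneous n g \<Longrightarrow> homogeneous n (f - g)"
  and homogeneous_scale: "homogeneous n f \<Longrightarrow> homogeneous n (scale_sym c f)"
  and homogeneous_uminus: "homogeneous n f \<Longrightarrow> homogeneous n (- f)"
  by (auto simp: homogeneous_def coeff_sym_one)

lemma homogeneous_sum: "(\<And>x. x \<in> A \<Longrightarrow> homogeneous n (f x)) \<Longrightarrow> homogeneous n (sum f A)"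
  by (induction A rule: infinite_finite_induct) (auto intro: homogeneous_add)

lemma homogeneous_prod:
  "(\<And>x. x \<in> A \<Longrightarrow> homogeneous (d x) (f x)) \<Longrightarrow> homogeneous (sum d A) (prod f A)"
  by (induction A rule: infinite_finite_induct) (auto intro: homogeneous_mult)

lemma homogeneous_complete_hom: "homogeneous n (complete_hom n)"
  by (simp add: homogeneous_def complete_hom.rep_eq)

lemma homogeneous_power_sum: "homogeneous (int k) (power_sum k)"
  by (auto simp: homogeneous_def coeff_sym_power_sum)

lemma homogeneous_psum: "homogeneous (int (\<Sum>\<^sub># K)) (psum K)"
  by (induction K) (auto intro: homogeneous_mult homogeneous_power_sum)

definition parts_of :: "nat \<Rightarrow> nat multiset set" where
  "parts_of n = {K. 0 \<notin># K \<and> \<Sum>\<^sub># K = n}"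

lemma size_le_sum_mset: "0 \<notin># K \<Longrightarrow> size K \<le> \<Sum>\<^sub># (K :: nat multiset)"
  by (induction K) auto

lemma finite_parts_of: "finite (parts_of n)"
proof -
  have "parts_of n \<subseteq> (\<Union>m\<le>n. {K. size K = m \<and> set_mset K \<subseteq> {..n}})"
    by (auto simp: parts_of_def size_le_sum_mset dest!: multi_member_split)
  moreover have "finite {K. size K = m \<and> set_mset K \<subseteq> {..n}}" for m
    using finite_multisets_of_size[of "{..n}" m]
    by (simp add: multisets_of_size_def conj_commute)
  ultimately show ?thesis by (auto intro: finite_subset)
qed

text \<open>
  Triangularity read as an algorithm: subtracting suitable multiples of the \<open>psum K\<close> with
  \<open>K\<close> of size \<open>l\<close> removes the monomials in \<open>l\<close> variables without creating monomials in
  more of them.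
\<close>

lemma homogeneous_in_span_psum:
  assumes "homogeneous (int n) f"
  shows "f \<in> sym.span (psum ` parts_of n)"
proof -
  have "f \<in> sym.span (psum ` parts_of n)"
    if "homogeneous (int n) f" "\<And>M. coeff_sym f M \<noteq> 0 \<Longrightarrow> card (set_mset M) < l" for l f
    using that
  proof (induction l arbitrary: f)
    case 0
    then have "f = 0" by (intro sym_eqI) auto
    then show ?case by (simp add: sym.span_zero)
  next
    case (Suc l)
    let ?S = "{K \<in> parts_of n. size K = l}"
    obtain m where m: "\<And>K. 0 \<notin># K \<Longrightarrow> exponents (m K) = K"
      using exists_exponents by metis
    define c where "c K = coeff_sym f (m K) / coeff_sym (psum K) (m K)" for K
    define g where "g = (\<Sum>K\<in>?S. scale_sym (c K) (psum K))"
    have finS: "finite ?S" using finite_parts_of by simp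
    have g_span: "g \<in> sym.span (psum ` parts_of n)"
      unfolding g_def by (intro sym.span_sum sym.span_scale sym.span_base) auto
    have homg: "homogeneous (int n) g"
      unfolding g_def using homogeneous_psum
      by (intro homogeneous_sum homogeneous_scale) (auto simp: parts_of_def)
    have "coeff_sym (f - g) M = 0" if M: "\<not> card (set_mset M) < l" for M
    proof (cases "card (set_mset M) = l \<and> size M = n")
      case True
      then have K: "exponents M \<in> ?S" by (simp add: parts_of_def)
      have "c K * coeff_sym (psum K) M = 0" if "K \<in> ?S - {exponents M}" for K
        using that coeff_psum_nonzero[of K M] True by (auto simp: parts_of_def)
      then have "coeff_sym g M = c (exponents M) * coeff_sym (psum (exponents M)) M"
        unfolding g_def coeff_sym_sum coeff_sym_scale
      using sum.mono_neutral_right[of ?S "{exponents M}" "\<lambda>K. c K * coeff_sym (psum K) M"] K finS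
      by auto
      also have "\<dots> = coeff_sym f M"
        using coeff_psum_pos[of M] coeff_sym_eq_exponents[of "m (exponents M)" M] m
        by (simp add: c_def)
      finally show ?thesis by simp
    next
      case False
      show ?thesis
      proof (cases "size M = n")
        case True
        with False M have l: "card (set_mset M) > l" by auto
        then have "coeff_sym f M = 0" using Suc.prems(2)[of M] by auto
        moreover have "coeff_sym (psum K) M = 0" if "K \<in> ?S" for K
          using coeff_psum_nonzero[of K M] that l by (auto simp: parts_of_def)
        ultimately show ?thesis by (simp add: g_def)
      next
        case False
        then show ?thesis using homg Suc.prems(1) by (auto simp: homogeneous_def)
      qed
    qed
    then have "f - g \<in> sym.span (psum ` parts_of n)"
      using homg Suc.prems(1) by (intro Suc.IH homogeneous_diff) blast+
    with g_span show ?case using sym.span_add by fastforce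
  qed
  moreover have "card (set_mset M) < Suc n" if "coeff_sym f M \<noteq> 0" for M
  proof -
    have "size M = n" using assms that by (auto simp: homogeneous_def)
    then show ?thesis using size_le_sum_mset[of "exponents M"] by simp
  qed
  ultimately show ?thesis using assms by blast
qed

lemma coeff_hom_component [simp]:
  "coeff_sym (hom_component n f) M = (if size M = n then coeff_sym f M else 0)"
  by (simp add: hom_component.rep_eq)

lemma homogeneous_hom_component: "homogeneous (int n) (hom_component n f)"
  by (simp add: homogeneous_def)

lemma finite_hom_components: "finite {n. hom_component n f \<noteq> 0}"
proof -
  obtain d where d: "\<And>M. size M > d \<Longrightarrow> coeff_sym f M = 0" using coeff_sym_bounded by blast
  have "{n. hom_component n f \<noteq> 0} \<subseteq> {..d}"
    using d by (force intro!: sym_eqI)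
  then show ?thesis by (rule finite_subset) simp
qed

lemma sum_hom_components: "(\<Sum>n | hom_component n f \<noteq> 0. hom_component n f) = f"
proof (rule sym_eqI)
  fix M
  have "(\<Sum>n | hom_component n f \<noteq> 0. if size M = n then coeff_sym f M else 0) = coeff_sym f M"
  proof (cases "hom_component (size M) f = 0")
    case True
    then have "coeff_sym f M = 0" by (metis coeff_hom_component coeff_sym_zero)
    then show ?thesis by (simp only: if_cancel sum.neutral_const)
  next
    case False
    then show ?thesis using finite_hom_components[of f] by (simp add: sum.delta')
  qed
  then show "coeff_sym (\<Sum>n | hom_component n f \<noteq> 0. hom_component n f) M = coeff_sym f M" by simp
qed

lemma span_psum: "f \<in> sym.span (psum ` {K. 0 \<notin># K})"
proof -
  have "hom_component n f \<in> sym.span (psum ` {K. 0 \<notin># K})" for n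
    using homogeneous_in_span_psum[OF homogeneous_hom_component]
      sym.span_mono[of "psum ` parts_of n" "psum ` {K. 0 \<notin># K}"]
    by (auto simp: parts_of_def)
  then have "(\<Sum>n | hom_component n f \<noteq> 0. hom_component n f) \<in> sym.span (psum ` {K. 0 \<notin># K})"
    by (intro sym.span_sum)
  then show ?thesis by (simp only: sum_hom_components)
qed

section \<open>Linear maps prescribed on products of power sums\<close>

abbreviation linear_sym :: "(sym \<Rightarrow> sym) \<Rightarrow> bool" where
  "linear_sym \<equiv> Vector_Spaces.linear scale_sym scale_sym"

abbreviation linear_rat :: "(sym \<Rightarrow> rat) \<Rightarrow> bool" where
  "linear_rat \<equiv> Vector_Spaces.linear scale_sym (*)"

global_interpretation rat_space: vector_space "(*) :: rat \<Rightarrow> rat \<Rightarrow> rat"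
  by standard (simp_all add: algebra_simps)

(* as a rewrite rule this would undo the associative law *)
declare rat_space.scale_scale [simp del]

global_interpretation sym_sym: vector_space_pair scale_sym scale_sym ..

global_interpretation sym_rat: vector_space_pair scale_sym "(*) :: rat \<Rightarrow> rat \<Rightarrow> rat" ..

lemma linear_symI:
  "(\<And>f g. T (f + g) = T f + T g) \<Longrightarrow> (\<And>c f. T (scale_sym c f) = scale_sym c (T f)) \<Longrightarrow> linear_sym T"
  by (simp add: Vector_Spaces.linear_iff sym.vector_space_axioms)

lemma linear_ratI:
  "(\<And>f g. T (f + g) = T f + T g) \<Longrightarrow> (\<And>c f. T (scale_sym c f) = c * T f) \<Longrightarrow> linear_rat T"
  by (simp add: Vector_Spaces.linear_iff sym.vector_space_axioms rat_space.vector_space_axioms)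

lemma scale_sym_mult_left: "scale_sym c f * g = scale_sym c (f * g)"
proof (rule sym_eqI)
  fix M
  show "coeff_sym (scale_sym c f * g) M = coeff_sym (scale_sym c (f * g)) M"
    unfolding coeff_sym_mult coeff_sym_scale sum_distrib_left
    by (rule sum.cong) (auto simp: mult.assoc)
qed

lemma scale_sym_mult_right: "f * scale_sym c g = scale_sym c (f * g)"
  using scale_sym_mult_left[of c g f] by (simp add: mult.commute)

lemma linear_sym_mult: "linear_sym (\<lambda>g. f * g)" "linear_sym (\<lambda>f. f * g)"
  by (auto intro!: linear_symI simp: scale_sym_mult_left scale_sym_mult_right algebra_simps)

lemma linear_sym_compose: "linear_sym S \<Longrightarrow> linear_sym T \<Longrightarrow> linear_sym (\<lambda>x. S (T x))"
  by (simp add: Vector_Spaces.linear_iff)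

lemma linear_rat_compose: "linear_rat S \<Longrightarrow> linear_sym T \<Longrightarrow> linear_rat (\<lambda>x. S (T x))"
  by (simp add: Vector_Spaces.linear_iff)

lemma linear_sym_add: "linear_sym S \<Longrightarrow> linear_sym T \<Longrightarrow> linear_sym (\<lambda>x. S x + T x)"
  by (simp add: Vector_Spaces.linear_iff sym.scale_right_distrib)

lemma linear_sym_sum: "(\<And>i. i \<in> A \<Longrightarrow> linear_sym (T i)) \<Longrightarrow> linear_sym (\<lambda>x. \<Sum>i\<in>A. T i x)"
  by (rule linear_symI)
    (simp_all add: Vector_Spaces.linear_iff sum.distrib sym.scale_sum_right)

lemma linear_sym_scale: "linear_rat T \<Longrightarrow> linear_sym (\<lambda>x. scale_sym (T x) g)"
  by (rule linear_symI) (simp_all add: Vector_Spaces.linear_iff sym.scale_left_distrib)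

lemma linear_sym_eqI:
  assumes "linear_sym S" "linear_sym T" "\<And>K. 0 \<notin># K \<Longrightarrow> S (psum K) = T (psum K)"
  shows "S f = T f"
  by (rule sym_sym.linear_eq_on[OF assms(1,2) span_psum]) (auto simp: assms(3))

lemma linear_rat_eqI:
  assumes "linear_rat S" "linear_rat T" "\<And>K. 0 \<notin># K \<Longrightarrow> S (psum K) = T (psum K)"
  shows "S f = T f"
  by (rule sym_rat.linear_eq_on[OF assms(1,2) span_psum]) (auto simp: assms(3))

lemma bilinear_sym_eqI:
  assumes "\<And>f. linear_sym (S f)" "\<And>g. linear_sym (\<lambda>f. S f g)"
    and "\<And>f. linear_sym (T f)" "\<And>g. linear_sym (\<lambda>f. T f g)"
    and "\<And>K L. 0 \<notin># K \<Longrightarrow> 0 \<notin># L \<Longrightarrow> S (psum K) (psum L) = T (psum K) (psum L)"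
  shows "S f g = T f g"
  by (rule linear_sym_eqI[OF assms(2,4)], rule linear_sym_eqI[OF assms(1,3)], rule assms(5))

lemma bilinear_rat_eqI:
  assumes "\<And>f. linear_rat (S f)" "\<And>g. linear_rat (\<lambda>f. S f g)"
    and "\<And>f. linear_rat (T f)" "\<And>g. linear_rat (\<lambda>f. T f g)"
    and "\<And>K L. 0 \<notin># K \<Longrightarrow> 0 \<notin># L \<Longrightarrow> S (psum K) (psum L) = T (psum K) (psum L)"
  shows "S f g = T f g"
  by (rule linear_rat_eqI[OF assms(2,4)], rule linear_rat_eqI[OF assms(1,3)], rule assms(5))

definition extend_sym :: "(nat multiset \<Rightarrow> sym) \<Rightarrow> sym \<Rightarrow> sym" where
  "extend_sym \<phi> = sym_sym.construct (psum ` {K. 0 \<notin># K}) (\<lambda>b. \<phi> (inv_into {K. 0 \<notin># K} psum b))"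

definition extend_rat :: "(nat multiset \<Rightarrow> rat) \<Rightarrow> sym \<Rightarrow> rat" where
  "extend_rat \<phi> = sym_rat.construct (psum ` {K. 0 \<notin># K}) (\<lambda>b. \<phi> (inv_into {K. 0 \<notin># K} psum b))"

lemma linear_extend_sym: "linear_sym (extend_sym \<phi>)"
  unfolding extend_sym_def by (rule sym_sym.linear_construct[OF independent_psum])

lemma linear_extend_rat: "linear_rat (extend_rat \<phi>)"
  unfolding extend_rat_def by (rule sym_rat.linear_construct[OF independent_psum])

lemma extend_sym_psum [simp]: "0 \<notin># K \<Longrightarrow> extend_sym \<phi> (psum K) = \<phi> K"
  unfolding extend_sym_def
  by (subst sym_sym.construct_basis[OF independent_psum]) (auto simp: inv_into_f_f[OF inj_on_psum])

lemma extend_rat_psum [simp]: "0 \<notin># K \<Longrightarrow> extend_rat \<phi> (psum K) = \<phi> K"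
  unfolding extend_rat_def
  by (subst sym_rat.construct_basis[OF independent_psum]) (auto simp: inv_into_f_f[OF inj_on_psum])

lemma linear_extend_sym_param:
  assumes "\<And>K. linear_sym (\<phi> K)"
  shows "linear_sym (\<lambda>f. extend_sym (\<lambda>K. \<phi> K f) g)"
proof (rule linear_symI)
  fix f f' c
  show "extend_sym (\<lambda>K. \<phi> K (f + f')) g = extend_sym (\<lambda>K. \<phi> K f) g + extend_sym (\<lambda>K. \<phi> K f') g"
    by (rule linear_sym_eqI[OF linear_extend_sym linear_sym_add[OF linear_extend_sym linear_extend_sym]])
      (simp add: sym_sym.linear_add[OF assms])
  show "extend_sym (\<lambda>K. \<phi> K (scale_sym c f)) g = scale_sym c (extend_sym (\<lambda>K. \<phi> K f) g)"
    by (rule linear_sym_eqI[OF linear_extend_sym sym_sym.linear_compose_scale_right[OF linear_extend_sym]])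
      (simp add: sym_sym.linear_scale[OF assms])
qed

lemma linear_extend_rat_param:
  assumes "\<And>K. linear_rat (\<phi> K)"
  shows "linear_rat (\<lambda>f. extend_rat (\<lambda>K. \<phi> K f) g)"
proof (rule linear_ratI)
  fix f f' c
  show "extend_rat (\<lambda>K. \<phi> K (f + f')) g = extend_rat (\<lambda>K. \<phi> K f) g + extend_rat (\<lambda>K. \<phi> K f') g"
    by (rule linear_rat_eqI[OF linear_extend_rat sym_rat.linear_compose_add[OF linear_extend_rat linear_extend_rat]])
      (simp add: sym_rat.linear_add[OF assms])
  show "extend_rat (\<lambda>K. \<phi> K (scale_sym c f)) g = c * (extend_rat (\<lambda>K. \<phi> K f) g)"
    by (rule linear_rat_eqI[OF linear_extend_rat sym_rat.linear_compose_scale_right[OF linear_extend_rat]])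
      (simp add: sym_rat.linear_scale[OF assms])
qed

section \<open>The inner product, its adjoints and the Kronecker product in terms of power sums\<close>

definition zmset :: "nat multiset \<Rightarrow> rat" where
  "zmset K = (\<Prod>i\<in>set_mset K. of_nat i ^ count K i * fact (count K i))"

lemma zmset_add: "zmset (add_mset k K) = of_nat k * of_nat (Suc (count K k)) * zmset K"
proof -
  let ?z = "\<lambda>K i. of_nat i ^ count K i * fact (count K i) :: rat"
  have "zmset (add_mset k K) = ?z (add_mset k K) k * (\<Prod>i\<in>set_mset K - {k}. ?z K i)"
    unfolding zmset_def by (simp add: prod.insert_remove)
  also have "\<dots> = of_nat k * of_nat (Suc (count K k)) * (?z K k * (\<Prod>i\<in>set_mset K - {k}. ?z K i))"
    by (simp add: algebra_simps)
  also have "?z K k * (\<Prod>i\<in>set_mset K - {k}. ?z K i) = zmset K"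
    unfolding zmset_def by (cases "k \<in># K") (simp_all add: prod.remove[of _ k] not_in_iff)
  finally show ?thesis .
qed

lemma zmset_nonzero: "0 \<notin># K \<Longrightarrow> zmset K \<noteq> 0"
  by (auto simp: zmset_def)

text \<open>
  The form for which the products of power sums are orthogonal with squared norms \<open>zmset\<close>.  It is
  the Hall inner product, but that is known only once the Schur functions are shown to be
  orthonormal for it.
\<close>

definition inner_sym :: "sym \<Rightarrow> sym \<Rightarrow> rat" where
  "inner_sym f g = extend_rat (\<lambda>L. extend_rat (\<lambda>K. if K = L then zmset L else 0) f) g"

lemma linear_inner_sym: "linear_rat (inner_sym f)" "linear_rat (\<lambda>f. inner_sym f g)"
  unfolding inner_sym_def
  by (intro linear_extend_rat linear_extend_rat_param)+

lemma inner_psum [simp]: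
  "0 \<notin># K \<Longrightarrow> 0 \<notin># L \<Longrightarrow> inner_sym (psum K) (psum L) = (if K = L then zmset L else 0)"
  by (simp add: inner_sym_def)

lemma inner_commute: "inner_sym f g = inner_sym g f"
  by (rule bilinear_rat_eqI) (auto intro!: linear_inner_sym)

lemma psum_expansion:
  obtains S a where "finite S" "S \<subseteq> {K. 0 \<notin># K}" "f = (\<Sum>K\<in>S. scale_sym (a K) (psum K))"
proof -
  obtain t r where t: "finite t" "t \<subseteq> psum ` {K. 0 \<notin># K}" "f = (\<Sum>v\<in>t. scale_sym (r v) v)"
    using span_psum[of f] unfolding sym.span_explicit by auto
  obtain S where S: "S \<subseteq> {K. 0 \<notin># K}" "t = psum ` S"
    using t(2) by (auto elim!: subset_imageE)
  have inj: "inj_on psum S" using inj_on_psum S(1) inj_on_subset by blast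
  then have "finite S" using t(1) S(2) finite_imageD by blast
  moreover have "f = (\<Sum>K\<in>S. scale_sym (r (psum K)) (psum K))"
    using t(3) S(2) inj by (simp add: sum.reindex)
  ultimately show thesis using S(1) that[of S "\<lambda>K. r (psum K)"] by blast
qed

lemma inner_sum_scale_left:
  "inner_sym (\<Sum>i\<in>A. scale_sym (c i) (f i)) g = (\<Sum>i\<in>A. c i * inner_sym (f i) g)"
  using sym_rat.linear_sum[OF linear_inner_sym(2), of "\<lambda>i. scale_sym (c i) (f i)" A g]
  by (simp add: sym_rat.linear_scale[OF linear_inner_sym(2)])

lemma inner_nondegenerate:
  assumes "\<And>h. inner_sym f h = inner_sym g h"
  shows "f = g"
proof -
  obtain S a where S: "finite S" "S \<subseteq> {K. 0 \<notin># K}" "f - g = (\<Sum>K\<in>S. scale_sym (a K) (psum K))"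
    using psum_expansion by blast
  have "a K = 0" if K: "K \<in> S" for K
  proof -
    have "0 = inner_sym (f - g) (psum K)"
      using assms by (simp add: sym_rat.linear_diff[OF linear_inner_sym(2)])
    also have "\<dots> = (\<Sum>L\<in>S. if L = K then a K * zmset K else 0)"
      unfolding S(3) inner_sum_scale_left using S(2) K
      by (intro sum.cong refl, subst inner_psum) auto
    also have "\<dots> = a K * zmset K" using K S(1) by simp
    finally show ?thesis using zmset_nonzero[of K] S(2) K by auto
  qed
  then have "f - g = 0" by (simp add: S(3))
  then show ?thesis by simp
qed

text \<open>
  The operator adjoint to multiplication by \<open>psum K\<close> sends \<open>psum L\<close> to a multiple of
  \<open>psum (L - K)\<close>; pairing with \<open>psum (L - K)\<close> determines the factor.
\<close>

definition skew_coeff :: "nat multiset \<Rightarrow> nat multiset \<Rightarrow> rat" where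
  "skew_coeff K L = (if K \<subseteq># L then zmset L / zmset (L - K) else 0)"

definition skew :: "sym \<Rightarrow> sym \<Rightarrow> sym" where
  "skew f g = extend_sym (\<lambda>L. extend_sym (\<lambda>K. scale_sym (skew_coeff K L) (psum (L - K))) f) g"

lemma linear_skew: "linear_sym (skew f)" "linear_sym (\<lambda>f. skew f g)"
  unfolding skew_def
  by (intro linear_extend_sym linear_extend_sym_param)+

lemma skew_psum [simp]:
  "0 \<notin># K \<Longrightarrow> 0 \<notin># L \<Longrightarrow> skew (psum K) (psum L) = scale_sym (skew_coeff K L) (psum (L - K))"
  by (simp add: skew_def)

lemma inner_skew: "inner_sym (skew f g) h = inner_sym g (f * h)"
proof (rule bilinear_rat_eqI[where S = "\<lambda>f g. inner_sym (skew f g) h" and T = "\<lambda>f g. inner_sym g (f * h)"])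
  fix K L :: "nat multiset" assume KL: "0 \<notin># K" "0 \<notin># L"
  have 0: "0 \<notin># L - K" using KL by (meson in_diffD)
  show "inner_sym (skew (psum K) (psum L)) h = inner_sym (psum L) (psum K * h)"
  proof (rule linear_rat_eqI[where f = h])
    fix M :: "nat multiset" assume M: "0 \<notin># M"
    have "skew_coeff K L * (if L - K = M then zmset M else 0) = (if L = K + M then zmset (K + M) else 0)"
      using zmset_nonzero[OF M] by (auto simp: skew_coeff_def)
    then show "inner_sym (skew (psum K) (psum L)) (psum M) = inner_sym (psum L) (psum K * psum M)"
      using KL 0 M by (simp add: sym_rat.linear_scale[OF linear_inner_sym(2)] flip: psum_union)
  qed (intro linear_inner_sym linear_rat_compose[OF linear_inner_sym(1)] linear_sym_mult)+
qed (intro linear_inner_sym linear_rat_compose[OF linear_inner_sym(1)]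
    linear_rat_compose[OF linear_inner_sym(2)] linear_sym_mult linear_skew)+

lemma skew_power_sum_psum:
  assumes "k > 0" "0 \<notin># K"
  shows "skew (power_sum k) (psum K) = scale_sym (of_nat (k * count K k)) (psum (K - {#k#}))"
proof (cases "k \<in># K")
  case True
  then obtain L where L: "K = add_mset k L" by (metis mset_add)
  then have "zmset L \<noteq> 0" using assms by (intro zmset_nonzero) auto
  then have "skew_coeff {#k#} K = of_nat (k * count K k)"
    using L by (simp add: skew_coeff_def zmset_add distrib_left)
  then show ?thesis using assms skew_psum[of "{#k#}" K] by simp
next
  case False
  then have "count K k = 0" "skew_coeff {#k#} K = 0" by (simp_all add: skew_coeff_def count_eq_zero_iff)
  then show ?thesis using assms skew_psum[of "{#k#}" K] by simp
qed

text \<open>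
  The product rule holds because multiplicities add: \<open>skew (power_sum k)\<close> multiplies \<open>psum K\<close> by
  \<open>k\<close> times the multiplicity of \<open>k\<close> in \<open>K\<close> and deletes one factor \<open>power_sum k\<close>.
\<close>

lemma skew_power_sum_mult:
  assumes k: "k > 0"
  shows "skew (power_sum k) (f * g) = skew (power_sum k) f * g + f * skew (power_sum k) g"
proof (rule bilinear_sym_eqI[where S = "\<lambda>f g. skew (power_sum k) (f * g)"])
  fix K L :: "nat multiset" assume KL: "0 \<notin># K" "0 \<notin># L"
  let ?t = "\<lambda>K. scale_sym (of_nat (k * count K k)) (psum (K - {#k#}))"
  have 1: "?t K * psum L = scale_sym (of_nat (k * count K k)) (psum (K + L - {#k#}))"
    by (cases "k \<in># K") (auto simp: scale_sym_mult_left not_in_iff simp flip: psum_union dest!: multi_member_split)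
  have 2: "psum K * ?t L = scale_sym (of_nat (k * count L k)) (psum (K + L - {#k#}))"
    by (cases "k \<in># L") (auto simp: scale_sym_mult_right not_in_iff simp flip: psum_union dest!: multi_member_split)
  have "skew (power_sum k) (psum (K + L)) = ?t K * psum L + psum K * ?t L"
    unfolding 1 2 using k KL
    by (subst skew_power_sum_psum) (auto simp: algebra_simps simp flip: sym.scale_left_distrib)
  then show "skew (power_sum k) (psum K * psum L) =
      skew (power_sum k) (psum K) * psum L + psum K * skew (power_sum k) (psum L)"
    using k KL by (simp add: skew_power_sum_psum psum_union)
qed (intro linear_sym_add linear_skew linear_sym_mult linear_sym_compose[OF linear_skew(1)]
    linear_sym_compose[OF linear_sym_mult(1)] linear_sym_compose[OF linear_sym_mult(2)])+

text \<open>
  The rule for products of power sums says that Kronecker multiplication by \<open>psum K\<close> is diagonal,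
  its eigenvalue at \<open>psum L\<close> being the inner product of the two; linearity then gives the
  eigenvalues for all \<open>f\<close>.
\<close>

definition kron :: "sym \<Rightarrow> sym \<Rightarrow> sym" where
  "kron f g = extend_sym (\<lambda>L. scale_sym (inner_sym f (psum L)) (psum L)) g"

lemma linear_kron: "linear_sym (kron f)" "linear_sym (\<lambda>f. kron f g)"
  unfolding kron_def
  by (intro linear_extend_sym linear_extend_sym_param linear_sym_scale linear_inner_sym)+

lemma kron_psum: "0 \<notin># L \<Longrightarrow> kron f (psum L) = scale_sym (inner_sym f (psum L)) (psum L)"
  by (simp add: kron_def)

lemma kron_commute: "kron f g = kron g f"
  by (rule bilinear_sym_eqI) (auto intro!: linear_kron simp: kron_psum)

definition minus_one :: "sym \<Rightarrow> sym" where
  "minus_one = extend_sym (\<lambda>K. \<Prod>k\<in>#K. power_sum k - 1)"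

lemma linear_minus_one: "linear_sym minus_one"
  unfolding minus_one_def by (rule linear_extend_sym)

lemma minus_one_psum: "0 \<notin># K \<Longrightarrow> minus_one (psum K) = (\<Prod>k\<in>#K. power_sum k - 1)"
  by (simp add: minus_one_def)

lemma minus_one_one: "minus_one 1 = 1"
  using minus_one_psum[of "{#}"] by simp

lemma minus_one_power_sum: "k > 0 \<Longrightarrow> minus_one (power_sum k) = power_sum k - 1"
  using minus_one_psum[of "{#k#}"] by simp

lemma minus_one_mult: "minus_one (f * g) = minus_one f * minus_one g"
  by (rule bilinear_sym_eqI[where S = "\<lambda>f g. minus_one (f * g)" and T = "\<lambda>f g. minus_one f * minus_one g"])
    (auto intro!: linear_sym_compose[OF linear_minus_one] linear_sym_mult linear_minus_one
      linear_sym_compose[OF linear_sym_mult(1)] linear_sym_compose[OF linear_sym_mult(2)]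
      simp: minus_one_psum simp flip: psum_union)

lemma partition_mset_inj:
  assumes "is_partition \<mu>" "is_partition \<nu>" "mset \<mu> = mset \<nu>"
  shows "\<mu> = \<nu>"
proof -
  have "sorted (rev \<mu>)" "sorted (rev \<nu>)"
    using assms(1,2) by (simp_all add: is_partition_def sorted_wrt_rev)
  then have "rev \<mu> = rev \<nu>" using assms(3) by (metis mset_rev properties_for_sort)
  then show ?thesis by simp
qed

lemma partition_exists:
  assumes "0 \<notin># K"
  obtains \<mu> where "is_partition \<mu>" "mset \<mu> = K"
proof -
  have "is_partition (rev (sorted_list_of_multiset K))"
    using assms sorted_sorted_list_of_multiset[of K] by (simp add: is_partition_def sorted_wrt_rev)
  then show thesis using that by simp
qed

lemma power_sums_eq: "power_sums \<mu> = psum (mset \<mu>)"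
  by (induction \<mu>) (simp_all add: power_sums_def)

lemma zee_eq: "of_nat (zee \<mu>) = zmset (mset \<mu>)"
  by (simp add: zee_def zmset_def count_mset)

lemma kronecker_eq: "kronecker = kron"
  unfolding kronecker_def
proof (rule the_equality, intro conjI allI impI)
  fix \<mu> \<nu> assume \<mu>\<nu>: "is_partition \<mu>" "is_partition \<nu>"
  then show "kron (power_sums \<mu>) (power_sums \<nu>) =
      (if \<mu> = \<nu> then scale_sym (of_nat (zee \<mu>)) (power_sums \<mu>) else 0)"
    using partition_mset_inj[OF \<mu>\<nu>] by (auto simp: power_sums_eq kron_psum is_partition_def zee_eq)
next
  fix B
  assume B: "(\<forall>f. linear_sym (B f)) \<and> (\<forall>g. linear_sym (\<lambda>f. B f g)) \<and>
     (\<forall>\<mu> \<nu>. is_partition \<mu> \<longrightarrow> is_partition \<nu> \<longrightarrow>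
        B (power_sums \<mu>) (power_sums \<nu>) =
          (if \<mu> = \<nu> then scale_sym (of_nat (zee \<mu>)) (power_sums \<mu>) else 0))"
  show "B = kron"
  proof (intro ext, rule bilinear_sym_eqI[where S = B and T = kron])
    fix K L :: "nat multiset" assume KL: "0 \<notin># K" "0 \<notin># L"
    obtain \<mu> \<nu> where "is_partition \<mu>" "mset \<mu> = K" "is_partition \<nu>" "mset \<nu> = L"
      using KL partition_exists by metis
    then show "B (psum K) (psum L) = kron (psum K) (psum L)"
      using B[THEN conjunct2, THEN conjunct2, rule_format, of \<mu> \<nu>] KL partition_mset_inj[of \<mu> \<nu>]
      by (auto simp: power_sums_eq kron_psum zee_eq)
  qed (use B linear_kron in auto)
qed (rule linear_kron)+

lemma subst_minus_one_eq: "subst_minus_one = minus_one"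
  unfolding subst_minus_one_def
proof (rule the_equality, intro conjI allI impI)
  fix \<phi>
  assume \<phi>: "linear_sym \<phi> \<and> \<phi> 1 = 1 \<and> (\<forall>f g. \<phi> (f * g) = \<phi> f * \<phi> g) \<and>
     (\<forall>k\<ge>1. \<phi> (power_sum k) = power_sum k - 1)"
  show "\<phi> = minus_one"
  proof (rule ext, rule linear_sym_eqI[where S = \<phi> and T = minus_one])
    fix K :: "nat multiset" assume "0 \<notin># K"
    then show "\<phi> (psum K) = minus_one (psum K)"
    proof (induction K)
      case (add k K)
      then show ?case using \<phi> by (simp add: minus_one_mult minus_one_power_sum)
    qed (use \<phi> in \<open>simp add: minus_one_one\<close>)
  qed (use \<phi> linear_minus_one in auto)
qed (auto simp: linear_minus_one minus_one_one minus_one_mult minus_one_power_sum)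

section \<open>Complete homogeneous functions\<close>

lemma coeff_complete_hom: "coeff_sym (complete_hom n) M = (if int (size M) = n then 1 else 0)"
  by (simp add: complete_hom.rep_eq)

lemma complete_hom_neg [simp]: "n < 0 \<Longrightarrow> complete_hom n = 0"
  by (rule sym_eqI) (simp add: coeff_complete_hom)

lemma complete_hom_zero [simp]: "complete_hom 0 = 1"
  by (rule sym_eqI) (simp add: coeff_complete_hom coeff_sym_one)

lemma coeff_power_sum_mult:
  assumes k: "k > 0"
  shows "coeff_sym (power_sum k * f) M =
    (\<Sum>x | k \<le> count M x. coeff_sym f (M - replicate_mset k x))"
proof -
  let ?X = "{x. k \<le> count M x}"
  let ?g = "\<lambda>x. (replicate_mset k x, M - replicate_mset k x)"
  have le: "k \<le> count M x \<longleftrightarrow> replicate_mset k x \<subseteq># M" for x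
    by (simp add: count_le_replicate_mset_subset_eq)
  have "(\<Sum>(A, B) | A + B = M. coeff_sym (power_sum k) A * coeff_sym f B) =
      (\<Sum>(A, B)\<in>?g ` ?X. coeff_sym (power_sum k) A * coeff_sym f B)"
  proof (rule sum.mono_neutral_right)
    show "?g ` ?X \<subseteq> {(A, B). A + B = M}"
      by (auto simp: le)
    show "\<forall>i\<in>{(A, B). A + B = M} - ?g ` ?X.
        (case i of (A, B) \<Rightarrow> coeff_sym (power_sum k) A * coeff_sym f B) = 0"
    proof
      fix p assume p: "p \<in> {(A, B). A + B = M} - ?g ` ?X"
      obtain A B where "p = (A, B)" by fastforce
      with p have AB: "(A, B) \<notin> ?g ` ?X" "M = A + B" by auto
      have "A \<noteq> replicate_mset k x" for x
      proof
        assume "A = replicate_mset k x"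
        then have "(A, B) = ?g x" "x \<in> ?X" using AB(2) by auto
        with AB(1) show False by blast
      qed
      then show "(case p of (A, B) \<Rightarrow> coeff_sym (power_sum k) A * coeff_sym f B) = 0"
        by (simp add: coeff_sym_power_sum \<open>p = (A, B)\<close>)
    qed
  qed (rule finite_mset_splits)
  also have "\<dots> = (\<Sum>x\<in>?X. coeff_sym (power_sum k) (replicate_mset k x) * coeff_sym f (M - replicate_mset k x))"
  proof -
    have "inj_on ?g ?X" using k by (auto simp: inj_on_def dest!: arg_cong[where f = set_mset])
    then show ?thesis by (simp add: sum.reindex)
  qed
  also have "\<dots> = (\<Sum>x\<in>?X. coeff_sym f (M - replicate_mset k x))"
    by (intro sum.cong) (auto simp: coeff_sym_power_sum)
  finally show ?thesis by (simp add: coeff_sym_mult)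
qed

text \<open>
  Newton's identity: a monomial of degree \<open>n\<close> arises on the right once for every nontrivial
  power of a variable that divides it, which is \<open>n\<close> times.
\<close>

lemma newton:
  "scale_sym (of_nat n) (complete_hom (int n)) =
     (\<Sum>k = 1..n. power_sum k * complete_hom (int n - int k))"
proof (rule sym_eqI)
  fix M :: "nat multiset"
  have 1: "coeff_sym (power_sum k * complete_hom (int n - int k)) M =
      (if size M = n then of_nat (card {x \<in> set_mset M. k \<le> count M x}) else 0)"
    if k: "k \<in> {1..n}" for k
  proof -
    have "coeff_sym (complete_hom (int n - int k)) (M - replicate_mset k x) = (if size M = n then 1 else 0)"
      if "k \<le> count M x" for x
    proof -
      have sub: "replicate_mset k x \<subseteq># M" using that by (simp add: count_le_replicate_mset_subset_eq)
      then have "size (M - replicate_mset k x) = size M - k" "k \<le> size M"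
        using size_mset_mono[OF sub] by (simp_all add: size_Diff_submset)
      then show ?thesis using k by (auto simp: coeff_complete_hom)
    qed
    then have "coeff_sym (power_sum k * complete_hom (int n - int k)) M =
        (\<Sum>x | k \<le> count M x. if size M = n then 1 else 0)"
      using k by (simp add: coeff_power_sum_mult)
    also have "{x. k \<le> count M x} = {x \<in> set_mset M. k \<le> count M x}"
      using k by (auto simp flip: count_greater_zero_iff)
    finally show ?thesis by simp
  qed
  have 2: "(\<Sum>k = 1..n. card {x \<in> set_mset M. k \<le> count M x}) = n" if n: "size M = n"
  proof -
    have "(\<Sum>k = 1..n. card {x \<in> set_mset M. k \<le> count M x}) =
        (\<Sum>k = 1..n. \<Sum>x\<in>set_mset M. if k \<le> count M x then 1 else 0)"
      by (simp add: sum.If_cases Int_def)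
    also have "\<dots> = (\<Sum>x\<in>set_mset M. \<Sum>k = 1..n. if k \<le> count M x then 1 else 0)"
      by (rule sum.swap)
    also have "\<dots> = (\<Sum>x\<in>set_mset M. count M x)"
    proof (rule sum.cong)
      fix x
      have "{1..n} \<inter> {k. k \<le> count M x} = {1..count M x}"
        using count_le_size[of M x] n by auto
      then show "(\<Sum>k = 1..n. if k \<le> count M x then 1 else 0) = count M x"
        by (simp add: sum.If_cases)
    qed simp
    also have "\<dots> = n" using n by (simp add: size_multiset_overloaded_eq)
    finally show ?thesis .
  qed
  show "coeff_sym (scale_sym (of_nat n) (complete_hom (int n))) M =
      coeff_sym (\<Sum>k = 1..n. power_sum k * complete_hom (int n - int k)) M"
  proof (cases "size M = n")
    case True
    then have "coeff_sym (\<Sum>k = 1..n. power_sum k * complete_hom (int n - int k)) M = of_nat n"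
      unfolding coeff_sym_sum using 1 by (simp only: True if_True 2[OF True] cong: sum.cong flip: of_nat_sum)
    then show ?thesis using True by (simp add: coeff_complete_hom)
  qed (use 1 in \<open>simp add: coeff_complete_hom\<close>)
qed

lemma scale_sym_cancel: "n > 0 \<Longrightarrow> scale_sym (of_nat n) f = scale_sym (of_nat n) g \<Longrightarrow> f = g"
  by simp

lemma skew_one_right: "k > 0 \<Longrightarrow> skew (power_sum k) 1 = 0"
  using skew_power_sum_psum[of k "{#}"] by simp

lemma skew_power_sum_power_sum:
  assumes "k > 0" "j > 0"
  shows "skew (power_sum k) (power_sum j) = (if k = j then scale_sym (of_nat k) 1 else 0)"
  using assms skew_power_sum_psum[of k "{#j#}"] by auto

text \<open>
  With \<open>skew (power_sum k)\<close> acting as \<open>k \<partial>/\<partial>p\<^sub>k\<close>, this is the differential equation satisfied by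
  the generating function \<open>exp (\<Sum> p\<^sub>k t\<^sup>k / k)\<close>; it is derived from Newton's identity by induction.
\<close>

lemma skew_complete_hom:
  assumes k: "k > 0"
  shows "skew (power_sum k) (complete_hom m) = complete_hom (m - int k)"
proof (cases "m < 0")
  case True
  then show ?thesis using k by (simp add: sym_sym.linear_0[OF linear_skew(1)])
next
  case False
  have "skew (power_sum k) (complete_hom (int n)) = complete_hom (int n - int k)" for n
  proof (induction n rule: less_induct)
    case (less n)
    show ?case
    proof (cases "n = 0")
      case True
      then show ?thesis using k by (simp add: skew_one_right)
    next
      case False
      let ?D = "skew (power_sum k)"
      have tail: "(\<Sum>j = 1..n. power_sum j * complete_hom (int n - int j - int k)) =
          (if k \<le> n then scale_sym (of_nat (n - k)) (complete_hom (int n - int k)) else 0)"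
      proof (cases "k \<le> n")
        case True
        have "(\<Sum>j = 1..n. power_sum j * complete_hom (int n - int j - int k)) =
            (\<Sum>j = 1..n - k. power_sum j * complete_hom (int (n - k) - int j))"
          using True by (intro sum.mono_neutral_cong_right) (auto simp: algebra_simps of_nat_diff)
        also have "\<dots> = scale_sym (of_nat (n - k)) (complete_hom (int (n - k)))"
          by (rule newton[symmetric])
        finally show ?thesis using True by (simp add: of_nat_diff)
      qed (auto intro!: sum.neutral)
      have "scale_sym (of_nat n) (?D (complete_hom (int n))) =
          ?D (\<Sum>j = 1..n. power_sum j * complete_hom (int n - int j))"
        by (simp add: sym_sym.linear_scale[OF linear_skew(1), symmetric] newton)
      also have "\<dots> = (\<Sum>j = 1..n. (if k = j then scale_sym (of_nat k) (complete_hom (int n - int j)) else 0) +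
          power_sum j * complete_hom (int n - int j - int k))"
        unfolding sym_sym.linear_sum[OF linear_skew(1)]
      proof (rule sum.cong)
        fix j assume j: "j \<in> {1..n}"
        then have "?D (complete_hom (int (n - j))) = complete_hom (int (n - j) - int k)"
          by (intro less.IH) auto
        then show "?D (power_sum j * complete_hom (int n - int j)) =
            (if k = j then scale_sym (of_nat k) (complete_hom (int n - int j)) else 0) +
            power_sum j * complete_hom (int n - int j - int k)"
          using j k by (simp add: skew_power_sum_mult skew_power_sum_power_sum scale_sym_mult_left of_nat_diff)
      qed simp
      also have "\<dots> = (if k \<le> n then scale_sym (of_nat k) (complete_hom (int n - int k)) else 0) +
          (if k \<le> n then scale_sym (of_nat (n - k)) (complete_hom (int n - int k)) else 0)"
        unfolding sum.distrib tail using k by (simp add: sum.delta)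
      also have "\<dots> = scale_sym (of_nat n) (complete_hom (int n - int k))"
        using False by (auto simp: of_nat_diff simp flip: sym.scale_left_distrib)
      finally show ?thesis using False by (auto intro: scale_sym_cancel[of n])
    qed
  qed
  from this[of "nat m"] False show ?thesis by simp
qed

text \<open>
  On generating functions the substitution multiplies \<open>exp (\<Sum> p\<^sub>k t\<^sup>k / k)\<close> by
  \<open>exp (- \<Sum> t\<^sup>k / k) = 1 - t\<close>.
\<close>

lemma minus_one_complete_hom: "minus_one (complete_hom m) = complete_hom m - complete_hom (m - 1)"
proof (cases "m < 0")
  case True
  then show ?thesis by (simp add: sym_sym.linear_0[OF linear_minus_one])
next
  case False
  have "minus_one (complete_hom (int n)) = complete_hom (int n) - complete_hom (int n - 1)" for n
  proof (induction n rule: less_induct)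
    case (less n)
    show ?case
    proof (cases "n = 0")
      case True
      then show ?thesis by (simp add: minus_one_one)
    next
      case False
      let ?h = complete_hom
      have "scale_sym (of_nat n) (minus_one (?h (int n))) =
          minus_one (\<Sum>k = 1..n. power_sum k * ?h (int n - int k))"
        by (simp add: sym_sym.linear_scale[OF linear_minus_one, symmetric] newton)
      also have "\<dots> = (\<Sum>k = 1..n. power_sum k * ?h (int n - int k)
          - power_sum k * ?h (int n - 1 - int k)
          - (?h (int n - int k) - ?h (int n - int (Suc k))))"
        unfolding sym_sym.linear_sum[OF linear_minus_one]
      proof (rule sum.cong)
        fix k assume k: "k \<in> {1..n}"
        then have "minus_one (?h (int (n - k))) = ?h (int (n - k)) - ?h (int (n - k) - 1)"
          by (intro less.IH) auto
        then have "minus_one (?h (int n - int k)) = ?h (int n - int k) - ?h (int n - int k - 1)"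
          using k by (simp only: of_nat_diff atLeastAtMost_iff)
        then have "minus_one (power_sum k * ?h (int n - int k)) =
            (power_sum k - 1) * (?h (int n - int k) - ?h (int n - int k - 1))"
          using k by (simp add: minus_one_mult minus_one_power_sum)
        then show "minus_one (power_sum k * ?h (int n - int k)) = power_sum k * ?h (int n - int k)
          - power_sum k * ?h (int n - 1 - int k) - (?h (int n - int k) - ?h (int n - int (Suc k)))"
          using k by (simp add: algebra_simps)
      qed simp
      also have "\<dots> = scale_sym (of_nat n) (?h (int n))
          - (\<Sum>k = 1..n. power_sum k * ?h (int n - 1 - int k)) - ?h (int n - 1)"
      proof -
        have "(\<Sum>k = 1..n. ?h (int n - int k) - ?h (int n - int (Suc k))) = ?h (int n - 1)"
          using sum_Suc_diff[of 1 n "\<lambda>k. - ?h (int n - int k)"] by simp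
        then show ?thesis by (simp only: sum_subtractf newton)
      qed
      also have "(\<Sum>k = 1..n. power_sum k * ?h (int n - 1 - int k)) =
          (\<Sum>k = 1..n - 1. power_sum k * ?h (int (n - 1) - int k))"
        using False by (intro sum.mono_neutral_cong_right) (auto simp: of_nat_diff)
      also have "\<dots> = scale_sym (of_nat (n - 1)) (?h (int (n - 1)))"
        by (rule newton[symmetric])
      also have "scale_sym (of_nat n) (?h (int n)) - scale_sym (of_nat (n - 1)) (?h (int (n - 1)))
          - ?h (int n - 1) = scale_sym (of_nat n) (?h (int n) - ?h (int n - 1))"
        using False by (simp add: of_nat_diff sym.scale_right_diff_distrib sym.scale_left_diff_distrib)
      finally show ?thesis using False by (auto intro: scale_sym_cancel[of n])
    qed
  qed
  from this[of "nat m"] False show ?thesis by simp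
qed

section \<open>Pairing with products of complete homogeneous functions extracts coefficients\<close>

definition monomial :: "nat \<Rightarrow> (nat \<Rightarrow> nat) \<Rightarrow> nat multiset" where
  "monomial N \<alpha> = (\<Sum>i<N. replicate_mset (\<alpha> i) i)"

lemma count_monomial: "count (monomial N \<alpha>) x = (if x < N then \<alpha> x else 0)"
  by (simp add: monomial_def count_sum)

lemma monomial_diff:
  "x < N \<Longrightarrow> monomial N \<alpha> - replicate_mset k x = monomial N (\<alpha>(x := \<alpha> x - k))"
  by (rule multiset_eqI) (simp add: count_monomial)

text \<open>Exponents are integers here, a monomial with a negative exponent having coefficient \<open>0\<close>.\<close>

definition exponent_coeff :: "nat \<Rightarrow> (nat \<Rightarrow> int) \<Rightarrow> sym \<Rightarrow> rat" where
  "exponent_coeff N \<alpha> f = (if \<forall>i<N. 0 \<le> \<alpha> i then coeff_sym f (monomial N (\<lambda>i. nat (\<alpha> i))) else 0)"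

lemma linear_exponent_coeff: "linear_rat (exponent_coeff N \<alpha>)"
  unfolding exponent_coeff_def by (rule linear_ratI) (simp_all del: not_all)

lemma exponent_coeff_power_sum_mult:
  assumes k: "k > 0"
  shows "exponent_coeff N \<alpha> (power_sum k * f) = (\<Sum>i<N. exponent_coeff N (\<alpha>(i := \<alpha> i - int k)) f)"
proof (cases "\<forall>i<N. 0 \<le> \<alpha> i")
  case True
  let ?M = "monomial N (\<lambda>i. nat (\<alpha> i))"
  have "exponent_coeff N \<alpha> (power_sum k * f) =
      (\<Sum>x | k \<le> count ?M x. coeff_sym f (?M - replicate_mset k x))"
    using True k by (simp add: exponent_coeff_def coeff_power_sum_mult)
  also have "\<dots> = (\<Sum>i<N. exponent_coeff N (\<alpha>(i := \<alpha> i - int k)) f)"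
  proof (rule sum.mono_neutral_cong_left)
    show "{x. k \<le> count ?M x} \<subseteq> {..<N}" using k by (auto simp: count_monomial split: if_splits)
    show "\<forall>i\<in>{..<N} - {x. k \<le> count ?M x}. exponent_coeff N (\<alpha>(i := \<alpha> i - int k)) f = 0"
      by (auto simp: count_monomial exponent_coeff_def)
  next
    fix x assume x: "x \<in> {x. k \<le> count ?M x}"
    then have x': "x < N" "k \<le> nat (\<alpha> x)" using k by (auto simp: count_monomial split: if_splits)
    then have "(\<lambda>i. nat (\<alpha> i))(x := nat (\<alpha> x) - k) = (\<lambda>i. nat ((\<alpha>(x := \<alpha> x - int k)) i))"
      by (auto simp: nat_diff_distrib fun_eq_iff)
    then have "?M - replicate_mset k x = monomial N (\<lambda>i. nat ((\<alpha>(x := \<alpha> x - int k)) i))"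
      using x' by (simp add: monomial_diff)
    then show "coeff_sym f (?M - replicate_mset k x) = exponent_coeff N (\<alpha>(x := \<alpha> x - int k)) f"
      using True x' k unfolding exponent_coeff_def by auto
  qed auto
  finally show ?thesis .
next
  case False
  then obtain j where j: "j < N" "\<alpha> j < 0" by force
  then have "exponent_coeff N (\<alpha>(i := \<alpha> i - int k)) f = 0" for i
    unfolding exponent_coeff_def by (auto intro!: exI[of _ j])
  then show ?thesis using False by (auto simp: exponent_coeff_def)
qed

lemma skew_power_sum_prod_complete_hom:
  assumes "k > 0" "finite A"
  shows "skew (power_sum k) (\<Prod>i\<in>A. complete_hom (\<alpha> i)) =
    (\<Sum>i\<in>A. \<Prod>j\<in>A. complete_hom ((\<alpha>(i := \<alpha> i - int k)) j))"
  using assms(2)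
proof (induction A)
  case (insert x A)
  have "(\<Prod>j\<in>insert x A. complete_hom ((\<alpha>(i := \<alpha> i - int k)) j)) =
      complete_hom (\<alpha> x) * (\<Prod>j\<in>A. complete_hom ((\<alpha>(i := \<alpha> i - int k)) j))" if "i \<in> A" for i
    using insert that by auto
  moreover have "(\<Prod>j\<in>insert x A. complete_hom ((\<alpha>(x := \<alpha> x - int k)) j)) =
      complete_hom (\<alpha> x - int k) * (\<Prod>j\<in>A. complete_hom (\<alpha> j))"
  proof -
    have "(\<Prod>j\<in>A. complete_hom ((\<alpha>(x := \<alpha> x - int k)) j)) = (\<Prod>j\<in>A. complete_hom (\<alpha> j))"
      using insert by (intro prod.cong) auto
    then show ?thesis using insert by simp
  qed
  ultimately show ?case
    using insert assms(1) by (simp add: skew_power_sum_mult skew_complete_hom sum_distrib_left)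
qed (use assms(1) in \<open>simp add: skew_one_right\<close>)

lemma coeff_empty_mult: "coeff_sym (f * g) {#} = coeff_sym f {#} * coeff_sym g {#}"
proof -
  have "{(A, B). A + B = ({#} :: nat multiset)} = {({#}, {#})}" by auto
  then show ?thesis by (simp add: coeff_sym_mult)
qed

lemma coeff_empty_prod: "coeff_sym (prod f A) {#} = (\<Prod>i\<in>A. coeff_sym (f i) {#})"
  by (induction A rule: infinite_finite_induct) (simp_all add: coeff_sym_one coeff_empty_mult)

lemma inner_one_right: "inner_sym f 1 = coeff_sym f {#}"
proof (rule linear_rat_eqI[of "\<lambda>f. inner_sym f 1" "\<lambda>f. coeff_sym f {#}"])
  show "linear_rat (\<lambda>f. coeff_sym f {#})" by (rule linear_ratI) simp_all
  fix K :: "nat multiset" assume K: "0 \<notin># K"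
  have "coeff_sym (psum K) {#} = 0" if "K \<noteq> {#}"
  proof -
    have "0 < \<Sum>\<^sub># K" using that size_le_sum_mset[OF K] by (meson nonempty_has_size order_less_le_trans)
    then show ?thesis using homogeneous_psum[of K] unfolding homogeneous_def by (metis nat_int size_empty less_irrefl)
  qed
  then show "inner_sym (psum K) 1 = coeff_sym (psum K) {#}"
    using inner_psum[OF K, of "{#}"] by (auto simp: zmset_def coeff_sym_one)
qed (rule linear_inner_sym)

text \<open>
  Complete homogeneous and monomial functions are dual.  Multiplication by \<open>power_sum k\<close> is adjoint
  to a derivation that lowers the index of one factor by \<open>k\<close>; on the side of the coefficients it
  lowers one exponent by \<open>k\<close>.
\<close>

lemma inner_prod_complete_hom:
  "inner_sym (\<Prod>i<N. complete_hom (\<alpha> i)) f = exponent_coeff N \<alpha> f"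
proof (rule linear_rat_eqI[OF linear_inner_sym(1) linear_exponent_coeff])
  fix K :: "nat multiset" assume "0 \<notin># K"
  then show "inner_sym (\<Prod>i<N. complete_hom (\<alpha> i)) (psum K) = exponent_coeff N \<alpha> (psum K)"
  proof (induction K arbitrary: \<alpha>)
    case empty
    have "monomial N (\<lambda>i. nat (\<alpha> i)) = {#} \<longleftrightarrow> (\<forall>i<N. nat (\<alpha> i) = 0)"
      by (auto simp: multiset_eq_iff count_monomial)
    moreover have "(\<Prod>i<N. coeff_sym (complete_hom (\<alpha> i)) {#}) = (if \<forall>i<N. \<alpha> i = 0 then 1 else 0)"
      by (auto simp: coeff_complete_hom intro!: prod_zero)
    moreover have "(\<forall>i<N. 0 \<le> \<alpha> i) \<and> (\<forall>i<N. nat (\<alpha> i) = 0) \<longleftrightarrow> (\<forall>i<N. \<alpha> i = 0)"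
      by (auto simp: order_antisym_conv)
    ultimately show ?case
      by (auto simp: inner_one_right coeff_empty_prod exponent_coeff_def coeff_sym_one)
  next
    case (add k K)
    then have k: "k > 0" by auto
    have "inner_sym (\<Prod>i<N. complete_hom (\<alpha> i)) (psum (add_mset k K)) =
        inner_sym (skew (power_sum k) (\<Prod>i<N. complete_hom (\<alpha> i))) (psum K)"
      by (simp add: inner_skew)
    also have "\<dots> = (\<Sum>i<N. inner_sym (\<Prod>j<N. complete_hom ((\<alpha>(i := \<alpha> i - int k)) j)) (psum K))"
      using k by (simp only: skew_power_sum_prod_complete_hom finite_lessThan
        sym_rat.linear_sum[OF linear_inner_sym(2)])
    also have "\<dots> = (\<Sum>i<N. exponent_coeff N (\<alpha>(i := \<alpha> i - int k)) (psum K))"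
      using add by (intro sum.cong) (auto simp del: fun_upd_apply)
    also have "\<dots> = exponent_coeff N \<alpha> (psum (add_mset k K))"
      using k by (simp add: exponent_coeff_power_sum_mult)
    finally show ?case .
  qed
qed

section \<open>Finitely many variables and the ratio of alternants\<close>

text \<open>
  All formal power series, without the symmetry and degree conditions on symmetric functions.
  Single variables and alternants, which are not symmetric, live in this ring.
\<close>

typedef series = "UNIV :: (nat multiset \<Rightarrow> rat) set"
  morphisms coeff_series Abs_series ..

setup_lifting type_definition_series

instantiation series :: comm_ring_1
begin

lift_definition zero_series :: series is "\<lambda>_. 0" .
lift_definition one_series :: series is "\<lambda>M. if M = {#} then 1 else 0" .
lift_definition plus_series :: "series \<Rightarrow> series \<Rightarrow> series" is "\<lambda>F G M. F M + G M" .
lift_definition uminus_series :: "series \<Rightarrow> series" is "\<lambda>F M. - F M" .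
lift_definition minus_series :: "series \<Rightarrow> series \<Rightarrow> series" is "\<lambda>F G M. F M - G M" .
lift_definition times_series :: "series \<Rightarrow> series \<Rightarrow> series" is cauchy .

instance
proof
  fix a b c :: series
  show "a * b * c = a * (b * c)" by transfer (rule cauchy_assoc)
  show "a * b = b * a" by transfer (rule cauchy_commute)
  show "1 * a = a" by transfer (rule cauchy_one)
  show "(a + b) * c = a * c + b * c"
    by transfer
       (auto simp: cauchy_def fun_eq_iff sum.distrib[symmetric] case_prod_unfold algebra_simps)
  show "a + b + c = a + (b + c)" by transfer (simp add: add.assoc)
  show "a + b = b + a" by transfer (simp add: add.commute)
  show "0 + a = a" by transfer simp
  show "- a + a = 0" by transfer simp
  show "a - b = a + - b" by transfer simp
  show "(0 :: series) \<noteq> 1" by transfer (auto simp: fun_eq_iff)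
qed

end

lemma series_eqI: "(\<And>M. coeff_series f M = coeff_series g M) \<Longrightarrow> f = g"
  by (simp add: coeff_series_inject[symmetric] fun_eq_iff)

lemma coeff_series_simps [simp]:
  "coeff_series (f + g) M = coeff_series f M + coeff_series g M"
  "coeff_series (f - g) M = coeff_series f M - coeff_series g M"
  "coeff_series (- f) M = - coeff_series f M"
  "coeff_series 0 M = 0"
  by (simp_all add: plus_series.rep_eq minus_series.rep_eq uminus_series.rep_eq zero_series.rep_eq)

lemma coeff_series_one: "coeff_series 1 M = (if M = {#} then 1 else 0)"
  by (simp add: one_series.rep_eq)

lemma coeff_series_sum [simp]: "coeff_series (sum f A) M = (\<Sum>x\<in>A. coeff_series (f x) M)"
  by (induction A rule: infinite_finite_induct) auto

lemma coeff_series_signof: "coeff_series (signof p * f) M = signof p * coeff_series f M"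
  by (cases p rule: sign_cases) simp_all

lift_definition monomial_series :: "nat multiset \<Rightarrow> series" is "\<lambda>A M. if M = A then 1 else 0" .

lemma coeff_monomial_series: "coeff_series (monomial_series A) M = (if M = A then 1 else 0)"
  by (simp add: monomial_series.rep_eq)

lemma coeff_monomial_series_mult:
  "coeff_series (monomial_series A * f) M = (if A \<subseteq># M then coeff_series f (M - A) else 0)"
proof -
  let ?h = "\<lambda>p. coeff_series (monomial_series A) (fst p) * coeff_series f (snd p)"
  have *: "coeff_series (monomial_series A * f) M = (\<Sum>p | fst p + snd p = M. ?h p)"
    by (simp add: times_series.rep_eq cauchy_def case_prod_unfold)
  show ?thesis
  proof (cases "A \<subseteq># M")
    case True
    have "(\<Sum>p | fst p + snd p = M. ?h p) = (\<Sum>p\<in>{(A, M - A)}. ?h p)"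
      using True finite_mset_splits[of M]
      by (intro sum.mono_neutral_right) (auto simp: case_prod_unfold coeff_monomial_series)
    then show ?thesis using True * by (simp add: coeff_monomial_series)
  next
    case False
    then have "(\<Sum>p | fst p + snd p = M. ?h p) = 0"
      by (intro sum.neutral) (auto simp: coeff_monomial_series)
    then show ?thesis using False * by simp
  qed
qed

lemma monomial_series_empty: "monomial_series {#} = 1"
  by (rule series_eqI) (simp add: coeff_monomial_series coeff_series_one)

lemma monomial_series_plus: "monomial_series (A + B) = monomial_series A * monomial_series B"
  by (rule series_eqI)
    (auto simp: coeff_monomial_series_mult coeff_monomial_series subset_mset.le_iff_add)

lemma prod_monomial_series: "(\<Prod>i\<in>I. monomial_series (A i)) = monomial_series (\<Sum>i\<in>I. A i)"
  by (induction I rule: infinite_finite_induct) (simp_all add: monomial_series_empty monomial_series_plus)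

definition var :: "nat \<Rightarrow> series" where
  "var i = monomial_series {#i#}"

lemma var_power: "var i ^ n = monomial_series (replicate_mset n i)"
  by (induction n) (simp_all add: var_def monomial_series_empty flip: monomial_series_plus)

lemma prod_var_power: "(\<Prod>i<N. var i ^ a i) = monomial_series (monomial N a)"
  by (simp add: var_power prod_monomial_series monomial_def)

text \<open>The value of a symmetric function at the variables with index below \<open>N\<close>, the others being \<open>0\<close>.\<close>

lift_definition restrict_vars :: "nat \<Rightarrow> sym \<Rightarrow> series" is
  "\<lambda>N F M. if set_mset M \<subseteq> {..<N} then F M else 0" .

lemma coeff_restrict_vars:
  "coeff_series (restrict_vars N f) M = (if set_mset M \<subseteq> {..<N} then coeff_sym f M else 0)"
  by (simp add: restrict_vars.rep_eq)

lemma restrict_vars_mult: "restrict_vars N (f * g) = restrict_vars N f * restrict_vars N g"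
proof (rule series_eqI)
  fix M
  show "coeff_series (restrict_vars N (f * g)) M =
      coeff_series (restrict_vars N f * restrict_vars N g) M"
  proof (cases "set_mset M \<subseteq> {..<N}")
    case True
    then have "coeff_series (restrict_vars N f) A * coeff_series (restrict_vars N g) B =
        coeff_sym f A * coeff_sym g B" if "A + B = M" for A B
      using that by (auto simp: coeff_restrict_vars)
    then show ?thesis using True
      by (auto simp: times_series.rep_eq cauchy_def coeff_restrict_vars coeff_sym_mult intro!: sum.cong)
  next
    case False
    then have "coeff_series (restrict_vars N f) A * coeff_series (restrict_vars N g) B = 0"
      if "A + B = M" for A B
      using that by (auto simp: coeff_restrict_vars)
    then have "coeff_series (restrict_vars N f * restrict_vars N g) M = 0"
      by (auto simp: times_series.rep_eq cauchy_def intro!: sum.neutral)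
    then show ?thesis using False by (simp add: coeff_restrict_vars)
  qed
qed

interpretation restrict_vars: comm_ring_hom "restrict_vars N"
  by standard (auto intro!: series_eqI simp: coeff_restrict_vars coeff_sym_one coeff_series_one restrict_vars_mult)

definition hom_fps :: "nat \<Rightarrow> series fps" where
  "hom_fps N = Abs_fps (\<lambda>n. restrict_vars N (complete_hom (int n)))"

lemma fps_nth_mult_linear:
  fixes c :: "'a :: comm_ring_1"
  shows "fps_nth (f * fps_of_poly [:1, - c:]) n = fps_nth f n - (if n = 0 then 0 else c * fps_nth f (n - 1))"
proof -
  have "fps_of_poly [:1, - c:] = 1 - fps_const c * fps_X"
    by (simp add: fps_of_poly_pCons)
  then have "f * fps_of_poly [:1, - c:] = f - fps_const c * (f * fps_X)"
    by (simp only: right_diff_distrib mult_1_right mult.left_commute)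
  then show ?thesis by simp
qed

text \<open>
  A monomial in the first \<open>N + 1\<close> variables either does not involve \<open>x\<^sub>N\<close> or is \<open>x\<^sub>N\<close> times a
  monomial of one degree less.
\<close>

lemma hom_fps_Suc: "hom_fps (Suc N) * fps_of_poly [:1, - var N:] = hom_fps N"
proof (rule fps_ext)
  fix n
  let ?h = "\<lambda>N n. restrict_vars N (complete_hom (int n))"
  have "?h (Suc N) (Suc n) - var N * ?h (Suc N) n = ?h N (Suc n)" for n
  proof (rule series_eqI)
    fix M
    show "coeff_series (?h (Suc N) (Suc n) - var N * ?h (Suc N) n) M = coeff_series (?h N (Suc n)) M"
    proof (cases "N \<in># M")
      case True
      then obtain M' where "M = add_mset N M'" by (metis mset_add)
      then show ?thesis
        by (auto simp: coeff_restrict_vars coeff_complete_hom var_def coeff_monomial_series_mult)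
    next
      case False
      then have "set_mset M \<subseteq> {..<Suc N} \<longleftrightarrow> set_mset M \<subseteq> {..<N}"
        by (auto simp: less_Suc_eq)
      with False show ?thesis
        by (simp add: coeff_restrict_vars coeff_complete_hom var_def coeff_monomial_series_mult)
    qed
  qed
  then have *: "?h (Suc N) n - (if n = 0 then 0 else var N * ?h (Suc N) (n - 1)) = ?h N n"
    by (cases n) simp_all
  have "fps_nth (hom_fps (Suc N) * fps_of_poly [:1, - var N:]) n =
      ?h (Suc N) n - (if n = 0 then 0 else var N * ?h (Suc N) (n - 1))"
    unfolding fps_nth_mult_linear by (simp add: hom_fps_def)
  then show "fps_nth (hom_fps (Suc N) * fps_of_poly [:1, - var N:]) n = fps_nth (hom_fps N) n"
    using * by (simp add: hom_fps_def)
qed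

lemma hom_fps_inverse: "hom_fps N * fps_of_poly (\<Prod>l<N. [:1, - var l:]) = 1"
proof (induction N)
  case 0
  have "restrict_vars 0 (complete_hom (int n)) = (if n = 0 then 1 else 0)" for n
    by (rule series_eqI) (auto simp: coeff_restrict_vars coeff_complete_hom coeff_series_one)
  then show ?case by (intro fps_ext) (simp add: hom_fps_def)
next
  case (Suc N)
  have "hom_fps (Suc N) * fps_of_poly (\<Prod>l<Suc N. [:1, - var l:]) =
      (hom_fps (Suc N) * fps_of_poly [:1, - var N:]) * fps_of_poly (\<Prod>l<N. [:1, - var l:])"
    by (simp only: prod.lessThan_Suc fps_of_poly_mult mult_ac)
  then show ?case by (simp only: hom_fps_Suc Suc)
qed

text \<open>
  Up to sign, the coefficients are the elementary symmetric functions of the first \<open>N\<close> variables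
  other than \<open>x\<^sub>i\<close>.
\<close>

definition elem_poly :: "nat \<Rightarrow> nat \<Rightarrow> series poly" where
  "elem_poly N i = (\<Prod>l\<in>{..<N} - {i}. [:1, - var l:])"

lemma degree_elem_poly: "i < N \<Longrightarrow> degree (elem_poly N i) < N"
proof -
  assume i: "i < N"
  have "degree (elem_poly N i) \<le> (\<Sum>l\<in>{..<N} - {i}. degree [:1, - var l:])"
    using degree_prod_sum_le[of "{..<N} - {i}" "\<lambda>l. [:1, - var l:]"]
    by (simp add: elem_poly_def comp_def)
  also have "\<dots> \<le> (\<Sum>l\<in>{..<N} - {i}. 1)" by (intro sum_mono) simp
  also have "\<dots> < N" using i by simp
  finally show ?thesis .
qed

lemma hom_fps_elem_poly:
  assumes i: "i < N"
  shows "hom_fps N * fps_of_poly (elem_poly N i) = Abs_fps (\<lambda>n. var i ^ n)"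
proof -
  let ?G = "Abs_fps (\<lambda>n. var i ^ n)"
  have "?G * fps_of_poly [:1, - var i:] = 1"
  proof (rule fps_ext)
    fix n
    show "fps_nth (?G * fps_of_poly [:1, - var i:]) n = fps_nth 1 n"
      unfolding fps_nth_mult_linear by (cases n) simp_all
  qed
  then have "hom_fps N * fps_of_poly (elem_poly N i) =
      hom_fps N * fps_of_poly (elem_poly N i) * (?G * fps_of_poly [:1, - var i:])" by simp
  also have "\<dots> = ?G * (hom_fps N * fps_of_poly ([:1, - var i:] * elem_poly N i))"
    by (simp only: fps_of_poly_mult mult_ac)
  also have "[:1, - var i:] * elem_poly N i = (\<Prod>l<N. [:1, - var l:])"
    using i unfolding elem_poly_def by (subst prod.remove[of _ i]) auto
  finally show ?thesis by (simp only: hom_fps_inverse mult_1_right)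
qed

lemma var_power_expansion:
  assumes i: "i < N"
  shows "var i ^ a = (\<Sum>k<N. restrict_vars N (complete_hom (int a - int k)) * coeff (elem_poly N i) k)"
proof -
  let ?t = "\<lambda>k. restrict_vars N (complete_hom (int a - int k)) * coeff (elem_poly N i) k"
  have "var i ^ a = fps_nth (fps_of_poly (elem_poly N i) * hom_fps N) a"
    using hom_fps_elem_poly[OF i] by (simp add: mult.commute)
  also have "\<dots> = (\<Sum>k = 0..a. ?t k)"
    unfolding fps_mult_nth by (intro sum.cong) (auto simp: hom_fps_def of_nat_diff)
  also have "\<dots> = (\<Sum>k \<in> {..<N} \<union> {0..a}. ?t k)"
    by (intro sum.mono_neutral_left) auto
  also have "\<dots> = (\<Sum>k<N. ?t k)"
    using degree_elem_poly[OF i] by (intro sum.mono_neutral_right) (auto simp: coeff_eq_0)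
  finally show ?thesis .
qed

definition alternant :: "nat list \<Rightarrow> series" where
  "alternant \<mu> = det (mat (length \<mu>) (length \<mu>) (\<lambda>(r, i). var i ^ (\<mu> ! r + (length \<mu> - 1 - r))))"

lemma schur_append_zero: "schur (\<alpha> @ [0]) = schur \<alpha>"
proof -
  let ?n = "length \<alpha>"
  let ?A = "mat (Suc ?n) (Suc ?n) (\<lambda>(i, j). complete_hom ((\<alpha> @ [0]) ! i + int j - int i))"
  have "det ?A = (\<Sum>j<Suc ?n. ?A $$ (?n, j) * cofactor ?A ?n j)"
    by (rule laplace_expansion_row) auto
  also have "\<dots> = cofactor ?A ?n ?n"
    by (simp add: nth_append)
  also have "mat_delete ?A ?n ?n = mat ?n ?n (\<lambda>(i, j). complete_hom (\<alpha> ! i + int j - int i))"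
    by (rule eq_matI) (auto simp: mat_delete_def nth_append)
  then have "cofactor ?A ?n ?n = schur \<alpha>"
    by (simp add: cofactor_def schur_def)
  finally show ?thesis by (simp add: schur_def)
qed

lemma schur_append_zeros: "schur (\<alpha> @ replicate k 0) = schur \<alpha>"
proof (induction k)
  case (Suc k)
  have "\<alpha> @ replicate (Suc k) 0 = (\<alpha> @ replicate k 0) @ [0]" by (simp add: replicate_append_same)
  then show ?case using Suc by (simp only: schur_append_zero)
qed simp

lemma schur_replicate_zero: "schur (replicate k 0) = 1"
  using schur_append_zeros[of "[]" k] by (simp add: schur_def)

text \<open>
  Jacobi's bialternant formula.  Reading off coefficients in
  \<open>H(t) \<Prod>\<^sub>l\<^sub>\<noteq>\<^sub>i (1 - x\<^sub>l t) = 1 / (1 - x\<^sub>i t)\<close> factors the matrix of the alternant as the Jacobi-Trudi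
  matrix times a matrix that does not depend on \<open>\<mu>\<close>; the determinant of the latter is found by
  taking \<open>\<mu> = 0\<close>.
\<close>

lemma bialternant:
  assumes N: "length \<mu> = N"
  shows "alternant \<mu> = restrict_vars N (schur_part \<mu>) * alternant (replicate N 0)"
proof -
  let ?E = "mat N N (\<lambda>(j, i). coeff (elem_poly N i) (N - 1 - j))"
  have *: "alternant \<nu> = restrict_vars N (schur_part \<nu>) * det ?E" if \<nu>: "length \<nu> = N" for \<nu>
  proof -
    let ?J = "mat N N (\<lambda>(i, j). complete_hom (map int \<nu> ! i + int j - int i))"
    have "mat N N (\<lambda>(r, i). var i ^ (\<nu> ! r + (N - 1 - r))) = map_mat (restrict_vars N) ?J * ?E"
    proof (rule eq_matI)
      fix r i assume "r < dim_row (map_mat (restrict_vars N) ?J * ?E)"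
        "i < dim_col (map_mat (restrict_vars N) ?J * ?E)"
      then have ri: "r < N" "i < N" by auto
      let ?a = "\<nu> ! r + (N - 1 - r)"
      have "(map_mat (restrict_vars N) ?J * ?E) $$ (r, i) =
          (\<Sum>j<N. restrict_vars N (complete_hom (int (\<nu> ! r) + int j - int r)) * coeff (elem_poly N i) (N - 1 - j))"
        using ri \<nu> by (simp add: scalar_prod_def atLeast0LessThan)
      also have "\<dots> = (\<Sum>k<N. restrict_vars N (complete_hom (int ?a - int k)) * coeff (elem_poly N i) k)"
        using ri
        by (intro sum.reindex_bij_witness[of _ "\<lambda>k. N - 1 - k" "\<lambda>k. N - 1 - k"])
          (auto simp: of_nat_diff algebra_simps)
      also have "\<dots> = var i ^ ?a" by (rule var_power_expansion[OF ri(2), symmetric])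
      finally show "mat N N (\<lambda>(r, i). var i ^ (\<nu> ! r + (N - 1 - r))) $$ (r, i) =
          (map_mat (restrict_vars N) ?J * ?E) $$ (r, i)" using ri by simp
    qed auto
    then have "alternant \<nu> = det (map_mat (restrict_vars N) ?J) * det ?E"
      unfolding alternant_def \<nu> by (simp add: det_mult[of _ N])
    then show ?thesis using \<nu> by (simp add: schur_def)
  qed
  have "schur_part (replicate N 0) = 1" using schur_replicate_zero[of N] by simp
  then have "alternant (replicate N 0) = det ?E" using *[of "replicate N 0"] by simp
  then show ?thesis using *[OF N] by simp
qed

section \<open>Schur functions are an orthonormal basis\<close>

lemma linear_rat_signof: "linear_rat T \<Longrightarrow> T (signof p * f) = signof p * T f"
  by (cases p rule: sign_cases) (simp_all add: sym_rat.linear_neg)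

lemma schur_leibniz:
  "schur \<alpha> = (\<Sum>p | p permutes {..<length \<alpha>}.
     signof p * (\<Prod>i<length \<alpha>. complete_hom (\<alpha> ! i + int (p i) - int i)))"
proof -
  let ?n = "length \<alpha>"
  have "schur \<alpha> = (\<Sum>p | p permutes {0..<?n}. signof p * (\<Prod>i = 0..<?n.
      mat ?n ?n (\<lambda>(i, j). complete_hom (\<alpha> ! i + int j - int i)) $$ (i, p i)))"
    unfolding schur_def by (rule det_def') simp
  also have "\<dots> = (\<Sum>p | p permutes {0..<?n}. signof p * (\<Prod>i = 0..<?n.
      complete_hom (\<alpha> ! i + int (p i) - int i)))"
    by (intro sum.cong refl arg_cong2[of _ _ _ _ "(*)"] prod.cong)
      (auto dest: permutes_in_image)
  finally show ?thesis by (simp only: atLeast0LessThan)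
qed

lemma inner_schur:
  "inner_sym (schur \<alpha>) f = (\<Sum>p | p permutes {..<length \<alpha>}.
     signof p * exponent_coeff (length \<alpha>) (\<lambda>i. \<alpha> ! i + int (p i) - int i) f)"
  unfolding schur_leibniz sym_rat.linear_sum[OF linear_inner_sym(2)]
  by (simp only: linear_rat_signof[OF linear_inner_sym(2)] inner_prod_complete_hom)

lemma alternant_leibniz:
  assumes N: "length \<mu> = N"
  shows "alternant \<mu> = (\<Sum>p | p permutes {..<N}.
    signof p * monomial_series (monomial N (\<lambda>i. \<mu> ! p i + (N - 1 - p i))))"
proof -
  let ?A = "mat N N (\<lambda>(r, i). var i ^ (\<mu> ! r + (N - 1 - r)))"
  have "alternant \<mu> = (\<Sum>p | p permutes {0..<N}. signof p * (\<Prod>i<N. ?A $$ (p i, i)))"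
    unfolding alternant_def N by (rule det_col) simp
  also have "\<dots> = (\<Sum>p | p permutes {0..<N}. signof p * (\<Prod>i<N. var i ^ (\<mu> ! p i + (N - 1 - p i))))"
    by (intro sum.cong refl arg_cong2[of _ _ _ _ "(*)"] prod.cong)
      (auto dest: permutes_in_image)
  finally show ?thesis by (simp only: atLeast0LessThan prod_var_power)
qed

text \<open>
  Both sides are signed sums over permutations \<open>p\<close> of coefficients of \<open>f\<close>.  The left side takes
  the exponents \<open>\<mu>\<^sub>i + p i - i\<close>, since complete homogeneous functions extract coefficients; the
  right side takes \<open>(\<mu>\<^sub>i + N - 1 - i) - (N - 1 - p i)\<close>, the subtracted exponents being those of a
  term of the Vandermonde determinant.
\<close>

lemma inner_schur_eq_coeff:
  assumes N: "length \<mu> = N"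
  shows "inner_sym (schur_part \<mu>) f =
    coeff_series (alternant (replicate N 0) * restrict_vars N f) (monomial N (\<lambda>i. \<mu> ! i + (N - 1 - i)))"
proof -
  let ?M = "monomial N (\<lambda>i. \<mu> ! i + (N - 1 - i))"
  have "signof p * exponent_coeff N (\<lambda>i. map int \<mu> ! i + int (p i) - int i) f =
      coeff_series (signof p * monomial_series (monomial N (\<lambda>i. N - 1 - p i)) * restrict_vars N f) ?M"
    if p: "p permutes {..<N}" for p
  proof -
    let ?A = "monomial N (\<lambda>i. N - 1 - p i)"
    have pi: "p i < N" if "i < N" for i using permutes_in_image[OF p, of i] that by simp
    have sub: "?A \<subseteq># ?M \<longleftrightarrow> (\<forall>i<N. 0 \<le> int (\<mu> ! i) + int (p i) - int i)"
    proof -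
      have "?A \<subseteq># ?M \<longleftrightarrow> (\<forall>i<N. N - 1 - p i \<le> \<mu> ! i + (N - 1 - i))"
        by (auto simp: subseteq_mset_def count_monomial)
      also have "\<dots> \<longleftrightarrow> (\<forall>i<N. 0 \<le> int (\<mu> ! i) + int (p i) - int i)"
      proof (intro all_cong1 imp_cong refl)
        fix i assume "i < N"
        with pi[of i] show "(N - 1 - p i \<le> \<mu> ! i + (N - 1 - i)) = (0 \<le> int (\<mu> ! i) + int (p i) - int i)"
          by auto
      qed
      finally show ?thesis .
    qed
    have "?M - ?A = monomial N (\<lambda>i. nat (int (\<mu> ! i) + int (p i) - int i))"
    proof (rule multiset_eqI)
      fix x
      show "count (?M - ?A) x = count (monomial N (\<lambda>i. nat (int (\<mu> ! i) + int (p i) - int i))) x"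
        using pi[of x] by (auto simp: count_monomial)
    qed
    moreover have "set_mset (monomial N a) \<subseteq> {..<N}" for a
      by (auto simp: count_monomial simp flip: count_greater_zero_iff split: if_splits)
    ultimately have "coeff_series (monomial_series ?A * restrict_vars N f) ?M =
        exponent_coeff N (\<lambda>i. int (\<mu> ! i) + int (p i) - int i) f"
      unfolding coeff_monomial_series_mult sub by (simp add: coeff_restrict_vars exponent_coeff_def del: not_all)
    also have "\<dots> = exponent_coeff N (\<lambda>i. map int \<mu> ! i + int (p i) - int i) f"
      using N by (auto simp: exponent_coeff_def monomial_def intro!: arg_cong[of _ _ "coeff_sym f"] sum.cong)
    finally show ?thesis by (simp only: mult.assoc coeff_series_signof)
  qed
  moreover have "monomial N (\<lambda>i. replicate N 0 ! p i + (N - 1 - p i)) = monomial N (\<lambda>i. N - 1 - p i)"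
    if p: "p permutes {..<N}" for p
    unfolding monomial_def using permutes_in_image[OF p] by (intro sum.cong) auto
  ultimately show ?thesis
    unfolding inner_schur alternant_leibniz[of "replicate N 0" N, OF length_replicate] sum_distrib_right
      coeff_series_sum length_map N
    by (intro sum.cong) auto
qed

lemma strict_antimono_permutation:
  fixes a b :: "nat \<Rightarrow> nat"
  assumes p: "p permutes {..<N}"
    and a: "\<And>i j. i < j \<Longrightarrow> j < N \<Longrightarrow> a j < a i"
    and b: "\<And>i j. i < j \<Longrightarrow> j < N \<Longrightarrow> b j < b i"
    and eq: "\<And>i. i < N \<Longrightarrow> a (p i) = b i"
  shows "p = id"
proof (rule permutes_natset_ge[OF p], rule ballI)
  have pN: "p i < N" if "i < N" for i using permutes_in_image[OF p, of i] that by simp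
  have mono: "p i < p j" if "i < j" "j < N" for i j
  proof (rule ccontr)
    assume "\<not> p i < p j"
    moreover have "p i \<noteq> p j" using p that by (metis permutes_inj injD less_irrefl)
    ultimately have "a (p i) < a (p j)" using a[of "p j" "p i"] pN that by auto
    then show False using b[OF that] eq[of i] eq[of j] that by auto
  qed
  fix i assume "i \<in> {..<N}"
  then have "i < N" by simp
  then show "i \<le> p i"
  proof (induction i)
    case (Suc i)
    then show ?case using mono[of i "Suc i"] by auto
  qed simp
qed

text \<open>
  Two strictly decreasing sequences that are rearrangements of each other are equal, so only the
  identity permutation contributes to the coefficient of \<open>x\<^bsup>\<lambda>+\<delta>\<^esup>\<close> in an alternant.
\<close>

lemma inner_schur_same_length:
  assumes \<mu>: "length \<mu> = N" "sorted_wrt (\<ge>) \<mu>" and \<nu>: "length \<nu> = N" "sorted_wrt (\<ge>) \<nu>"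
  shows "inner_sym (schur_part \<mu>) (schur_part \<nu>) = (if \<mu> = \<nu> then 1 else 0)"
proof -
  let ?a = "\<lambda>\<mu> i. \<mu> ! i + (N - 1 - i)"
  have decr: "?a \<kappa> j < ?a \<kappa> i" if "sorted_wrt (\<ge>) \<kappa>" "length \<kappa> = N" "i < j" "j < N" for \<kappa> :: "nat list" and i j
  proof -
    have "\<kappa> ! j \<le> \<kappa> ! i" using that by (simp add: sorted_wrt_iff_nth_less)
    then show ?thesis using that by simp
  qed
  have contribution: "signof p * coeff_series (monomial_series (monomial N (\<lambda>i. ?a \<nu> (p i)))) (monomial N (?a \<mu>)) =
      (if p = id then if \<mu> = \<nu> then 1 else 0 else 0)" if p: "p permutes {..<N}" for p
  proof (cases "monomial N (?a \<mu>) = monomial N (\<lambda>i. ?a \<nu> (p i))")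
    case True
    have eq: "?a \<nu> (p i) = ?a \<mu> i" if "i < N" for i
      using arg_cong[OF True, of "\<lambda>M. count M i"] that by (simp only: count_monomial if_True)
    have "p = id"
      using p by (rule strict_antimono_permutation[where a = "?a \<nu>" and b = "?a \<mu>"])
        (use decr \<mu> \<nu> eq in auto)
    moreover have "\<mu> = \<nu>"
    proof (rule nth_equalityI)
      fix i assume "i < length \<mu>"
      then show "\<mu> ! i = \<nu> ! i" using eq[of i] \<open>p = id\<close> \<mu>(1) by (simp only: id_apply add_right_cancel)
    qed (simp add: \<mu>(1) \<nu>(1))
    ultimately show ?thesis using True by (simp add: coeff_monomial_series sign_id)
  next
    case False
    then show ?thesis by (auto simp: coeff_monomial_series)
  qed
  have "inner_sym (schur_part \<mu>) (schur_part \<nu>) = coeff_series (alternant \<nu>) (monomial N (?a \<mu>))"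
    using bialternant[OF \<nu>(1)] by (simp add: inner_schur_eq_coeff[OF \<mu>(1)] mult.commute)
  also have "\<dots> = (\<Sum>p | p permutes {..<N}. if p = id then if \<mu> = \<nu> then 1 else 0 else 0)"
    unfolding alternant_leibniz[OF \<nu>(1)] coeff_series_sum coeff_series_signof
    by (intro sum.cong) (use contribution in auto)
  also have "\<dots> = (if \<mu> = \<nu> then 1 else 0)"
    by (subst sum.delta) (auto simp: finite_permutations permutes_id)
  finally show ?thesis .
qed

text \<open>
  The lengths are made equal by appending zeros, which does not change the Schur function.  Since a
  partition has no zero entries, the original is recovered from the padded sequence.
\<close>

lemma inner_schur_part:
  assumes "is_partition \<mu>" "is_partition \<nu>"
  shows "inner_sym (schur_part \<mu>) (schur_part \<nu>) = (if \<mu> = \<nu> then 1 else 0)"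
proof -
  define N where "N = max (length \<mu>) (length \<nu>)"
  let ?pad = "\<lambda>\<kappa>. \<kappa> @ replicate (N - length \<kappa>) (0 :: nat)"
  have schur_pad: "schur_part (?pad \<kappa>) = schur_part \<kappa>" for \<kappa>
    using schur_append_zeros[of "map int \<kappa>" "N - length \<kappa>"] by simp
  have zeros: "sorted_wrt (\<ge>) (replicate k (0 :: nat))" for k by (induction k) auto
  have pad: "length (?pad \<kappa>) = N" "sorted_wrt (\<ge>) (?pad \<kappa>)" "filter (\<lambda>i. i \<noteq> 0) (?pad \<kappa>) = \<kappa>"
    if "is_partition \<kappa>" "\<kappa> = \<mu> \<or> \<kappa> = \<nu>" for \<kappa>
  proof -
    have "0 \<notin> set \<kappa>" using that by (simp add: is_partition_def)
    then have "filter (\<lambda>i. i \<noteq> 0) \<kappa> = \<kappa>" by (intro filter_True) metis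
    then show "length (?pad \<kappa>) = N" "sorted_wrt (\<ge>) (?pad \<kappa>)" "filter (\<lambda>i. i \<noteq> 0) (?pad \<kappa>) = \<kappa>"
      using that by (auto simp: N_def is_partition_def sorted_wrt_append zeros)
  qed
  have "?pad \<mu> = ?pad \<nu> \<longleftrightarrow> \<mu> = \<nu>"
    using pad(3)[of \<mu>] pad(3)[of \<nu>] assms by metis
  then show ?thesis
    using inner_schur_same_length[OF pad(1,2) pad(1,2)] assms schur_pad by metis
qed

lemma homogeneous_schur_part: "homogeneous (int (sum_list \<mu>)) (schur_part \<mu>)"
proof -
  let ?n = "length \<mu>"
  have "homogeneous (int (sum_list \<mu>)) (signof p * (\<Prod>i<?n. complete_hom (map int \<mu> ! i + int (p i) - int i)))"
    if p: "p permutes {..<?n}" for p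
  proof -
    have "(\<Sum>i<?n. int (p i)) = (\<Sum>i<?n. int i)"
      using sum.permute[OF p, of int] by (simp add: comp_def)
    then have "(\<Sum>i<?n. map int \<mu> ! i + int (p i) - int i) = int (sum_list \<mu>)"
      by (simp add: sum.distrib sum_subtractf sum_list_sum_nth atLeast0LessThan)
    then have "homogeneous (int (sum_list \<mu>)) (\<Prod>i<?n. complete_hom (map int \<mu> ! i + int (p i) - int i))"
      using homogeneous_prod[of "{..<?n}" "\<lambda>i. map int \<mu> ! i + int (p i) - int i"
          "\<lambda>i. complete_hom (map int \<mu> ! i + int (p i) - int i)"] homogeneous_complete_hom
      by simp
    then show ?thesis by (cases p rule: sign_cases) (simp_all add: homogeneous_uminus)
  qed
  then show ?thesis
    unfolding schur_leibniz by (intro homogeneous_sum) simp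
qed

definition partitions_of :: "nat \<Rightarrow> nat list set" where
  "partitions_of n = {\<mu>. is_partition \<mu> \<and> sum_list \<mu> = n}"

lemma bij_betw_partitions_of: "bij_betw mset (partitions_of n) (parts_of n)"
proof (rule bij_betw_imageI)
  show "inj_on mset (partitions_of n)"
    by (auto simp: inj_on_def partitions_of_def partition_mset_inj)
  show "mset ` partitions_of n = parts_of n"
  proof
    show "mset ` partitions_of n \<subseteq> parts_of n"
      by (auto simp: partitions_of_def parts_of_def is_partition_def sum_mset_sum_list)
    show "parts_of n \<subseteq> mset ` partitions_of n"
    proof
      fix K assume K: "K \<in> parts_of n"
      then obtain \<mu> where "is_partition \<mu>" "mset \<mu> = K"
        using partition_exists[of K] by (auto simp: parts_of_def)
      then show "K \<in> mset ` partitions_of n"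
        using K by (auto simp: partitions_of_def parts_of_def sum_mset_sum_list)
    qed
  qed
qed

lemma finite_partitions_of: "finite (partitions_of n)"
  using bij_betw_finite[OF bij_betw_partitions_of] finite_parts_of by blast

lemma inj_on_schur_part: "inj_on schur_part {\<mu>. is_partition \<mu>}"
  using inner_schur_part by (intro inj_onI) (metis mem_Collect_eq zero_neq_one)

lemma independent_schur_part: "sym.independent (schur_part ` {\<mu>. is_partition \<mu>})"
proof -
  have "u v = 0" if S: "finite S" "S \<subseteq> schur_part ` {\<mu>. is_partition \<mu>}" "(\<Sum>v\<in>S. scale_sym (u v) v) = 0"
    and v: "v \<in> S" for S u v
  proof -
    have "inner_sym w v = (if w = v then 1 else 0)" if w: "w \<in> S" for w
    proof -
      obtain \<mu> \<nu> where "is_partition \<mu>" "w = schur_part \<mu>" "is_partition \<nu>" "v = schur_part \<nu>"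
        using w v S(2) by blast
      then show ?thesis by (auto simp: inner_schur_part dest: inj_onD[OF inj_on_schur_part])
    qed
    then have "inner_sym (\<Sum>w\<in>S. scale_sym (u w) w) v = (\<Sum>w\<in>S. if w = v then u v else 0)"
      unfolding inner_sum_scale_left by (intro sum.cong) auto
    also have "\<dots> = u v" using S(1) v by simp
    finally show ?thesis using S(3) by (simp add: sym_rat.linear_0[OF linear_inner_sym(2)])
  qed
  then show ?thesis unfolding sym.dependent_explicit by blast
qed

text \<open>
  In each degree there are as many Schur functions as products of power sums, so the
  independent Schur functions exhaust the space by the exchange lemma.
\<close>

lemma psum_in_span_schur_part:
  assumes K: "K \<in> parts_of n"
  shows "psum K \<in> sym.span (schur_part ` partitions_of n)"
proof -
  let ?S = "schur_part ` partitions_of n" and ?T = "psum ` parts_of n"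
  have fin: "finite ?T" "finite ?S" by (simp_all add: finite_parts_of finite_partitions_of)
  have indep: "sym.independent ?S"
    by (rule sym.independent_mono[OF independent_schur_part]) (auto simp: partitions_of_def)
  have span: "?S \<subseteq> sym.span ?T"
    using homogeneous_in_span_psum homogeneous_schur_part by (auto simp: partitions_of_def)
  have "inj_on schur_part (partitions_of n)"
    by (rule inj_on_subset[OF inj_on_schur_part]) (auto simp: partitions_of_def)
  moreover have "inj_on psum (parts_of n)"
    by (rule inj_on_subset[OF inj_on_psum]) (auto simp: parts_of_def)
  ultimately have card: "card ?S = card ?T"
    using bij_betw_same_card[OF bij_betw_partitions_of] by (simp add: card_image)
  have "x \<in> sym.span ?S" if x: "x \<in> ?T" for x
  proof (rule ccontr)
    assume notin: "x \<notin> sym.span ?S"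
    then have "sym.independent (insert x ?S)" "x \<notin> ?S"
      using indep by (auto simp: sym.independent_insert intro: sym.span_base)
    moreover have "insert x ?S \<subseteq> sym.span ?T" using span x by (auto intro: sym.span_base)
    ultimately have "card (insert x ?S) \<le> card ?T"
      using sym.independent_span_bound[OF fin(1)] by blast
    then show False using card \<open>x \<notin> ?S\<close> fin(2) by simp
  qed
  then show ?thesis using K by blast
qed

lemma span_schur_part: "f \<in> sym.span (schur_part ` {\<mu>. is_partition \<mu>})"
proof -
  have "psum ` {K. 0 \<notin># K} \<subseteq> sym.span (schur_part ` {\<mu>. is_partition \<mu>})"
  proof clarify
    fix K :: "nat multiset" assume "0 \<notin># K"
    then have "psum K \<in> sym.span (schur_part ` partitions_of (\<Sum>\<^sub># K))"
      by (intro psum_in_span_schur_part) (simp add: parts_of_def)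
    moreover have "sym.span (schur_part ` partitions_of (\<Sum>\<^sub># K)) \<subseteq> sym.span (schur_part ` {\<mu>. is_partition \<mu>})"
      by (intro sym.span_mono) (auto simp: partitions_of_def)
    ultimately show "psum K \<in> sym.span (schur_part ` {\<mu>. is_partition \<mu>})" by blast
  qed
  then have "sym.span (psum ` {K. 0 \<notin># K}) \<subseteq> sym.span (schur_part ` {\<mu>. is_partition \<mu>})"
    by (rule sym.span_minimal) simp
  then show ?thesis using span_psum by blast
qed

lemma linear_rat_schur_eqI:
  assumes "linear_rat S" "linear_rat T" "\<And>\<mu>. is_partition \<mu> \<Longrightarrow> S (schur_part \<mu>) = T (schur_part \<mu>)"
  shows "S f = T f"
  by (rule sym_rat.linear_eq_on[OF assms(1,2) span_schur_part]) (auto simp: assms(3))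

lemma linear_sym_schur_eqI:
  assumes "linear_sym S" "linear_sym T" "\<And>\<mu>. is_partition \<mu> \<Longrightarrow> S (schur_part \<mu>) = T (schur_part \<mu>)"
  shows "S f = T f"
  by (rule sym_sym.linear_eq_on[OF assms(1,2) span_schur_part]) (auto simp: assms(3))

lemma psum_schur_expansion:
  assumes K: "0 \<notin># K" and A: "finite A" "A \<subseteq> {\<mu>. is_partition \<mu>}" "partitions_of (\<Sum>\<^sub># K) \<subseteq> A"
  shows "psum K = (\<Sum>\<mu>\<in>A. scale_sym (inner_sym (psum K) (schur_part \<mu>)) (schur_part \<mu>))"
proof -
  have "psum K \<in> sym.span (schur_part ` partitions_of (\<Sum>\<^sub># K))"
    using K by (intro psum_in_span_schur_part) (simp add: parts_of_def)
  then have mem: "psum K \<in> sym.span (schur_part ` A)"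
    using sym.span_mono[OF image_mono[OF A(3)]] by blast
  show ?thesis
  proof (rule sym_sym.linear_eq_on[of "\<lambda>f. f" "\<lambda>f. \<Sum>\<mu>\<in>A. scale_sym (inner_sym f (schur_part \<mu>)) (schur_part \<mu>)", OF _ _ mem])
    fix b assume "b \<in> schur_part ` A"
    then obtain \<nu> where \<nu>: "\<nu> \<in> A" "b = schur_part \<nu>" by blast
    have "(\<Sum>\<mu>\<in>A. scale_sym (inner_sym b (schur_part \<mu>)) (schur_part \<mu>)) =
        (\<Sum>\<mu>\<in>A. if \<mu> = \<nu> then schur_part \<nu> else 0)"
      using \<nu> A(2) by (intro sum.cong) (auto simp: inner_schur_part subset_iff)
    then show "b = (\<Sum>\<mu>\<in>A. scale_sym (inner_sym b (schur_part \<mu>)) (schur_part \<mu>))"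
      using \<nu> A(1) by simp
  next
    show "linear_sym (\<lambda>f. f)" by (rule linear_symI) simp_all
  qed (intro linear_sym_sum linear_sym_scale linear_inner_sym)
qed

lemma hall_eq: "hall = inner_sym"
  unfolding hall_def
proof (rule the_equality, intro conjI allI impI)
  fix B
  assume B: "(\<forall>f. linear_rat (B f)) \<and> (\<forall>g. linear_rat (\<lambda>f. B f g)) \<and>
     (\<forall>\<mu> \<nu>. is_partition \<mu> \<longrightarrow> is_partition \<nu> \<longrightarrow>
        B (schur_part \<mu>) (schur_part \<nu>) = (if \<mu> = \<nu> then 1 else 0))"
  show "B = inner_sym"
  proof (intro ext)
    fix f g
    show "B f g = inner_sym f g"
    proof (rule linear_rat_schur_eqI[of "\<lambda>f. B f g" "\<lambda>f. inner_sym f g"])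
      fix \<mu> assume \<mu>: "is_partition \<mu>"
      show "B (schur_part \<mu>) g = inner_sym (schur_part \<mu>) g"
        by (rule linear_rat_schur_eqI) (use B \<mu> in \<open>auto simp: linear_inner_sym inner_schur_part\<close>)
    qed (use B in \<open>auto simp: linear_inner_sym\<close>)
  qed
qed (auto simp: linear_inner_sym inner_schur_part)

lemma D_op_eq: "D_op f = skew f"
  unfolding D_op_def hall_eq U_op_def
proof (rule the_equality)
  fix D assume "\<forall>g h. inner_sym (D g) h = inner_sym g (f * h)"
  then show "D = skew f" by (intro ext inner_nondegenerate) (simp add: inner_skew)
qed (simp add: inner_skew)

section \<open>The operators on products of power sums\<close>

lemma inner_complete_hom_psum:
  "0 \<notin># K \<Longrightarrow> inner_sym (complete_hom n) (psum K) = (if n = int (\<Sum>\<^sub># K) then 1 else 0)"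
proof (induction K arbitrary: n)
  case empty
  then show ?case by (simp add: inner_one_right coeff_complete_hom)
next
  case (add k K)
  then have "inner_sym (complete_hom n) (psum (add_mset k K)) = inner_sym (complete_hom (n - int k)) (psum K)"
    by (simp flip: inner_skew add: skew_complete_hom)
  then show ?case using add by auto
qed

lemma inner_homogeneous_psum:
  assumes "homogeneous (int n) f" "0 \<notin># K" "\<Sum>\<^sub># K \<noteq> n"
  shows "inner_sym f (psum K) = 0"
proof -
  have "inner_sym f (psum K) = (\<lambda>_. 0) f"
    by (rule sym_rat.linear_eq_on[OF linear_inner_sym(2) _ homogeneous_in_span_psum[OF assms(1)]])
      (use assms in \<open>auto simp: parts_of_def intro!: linear_ratI\<close>)
  then show ?thesis by simp
qed

text \<open>
  The eigenvalue at \<open>psum L\<close> of both operators to be compared, as a linear functional of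
  \<open>f[X - 1]\<close>.
\<close>

definition weight :: "nat multiset \<Rightarrow> sym \<Rightarrow> rat" where
  "weight L = extend_rat (\<lambda>K. skew_coeff K L)"

lemma linear_weight: "linear_rat (weight L)"
  unfolding weight_def by (rule linear_extend_rat)

lemma weight_psum [simp]: "0 \<notin># K \<Longrightarrow> weight L (psum K) = skew_coeff K L"
  by (simp add: weight_def)

text \<open>
  Moving \<open>g = psum K\<close> to the other side by adjointness leaves \<open>skew_coeff K L\<close> times the pairing
  of a complete homogeneous function with \<open>psum (L - K)\<close>.  If \<open>K \<subseteq># L\<close>, both have the same degree
  and the pairing is \<open>1\<close>; otherwise the coefficient vanishes.
\<close>

lemma inner_complete_hom_mult:
  assumes g: "homogeneous j g" and L: "0 \<notin># L"
  shows "inner_sym (complete_hom (int (\<Sum>\<^sub># L) - j) * g) (psum L) = weight L g"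
proof (cases "j < 0")
  case True
  then have "g = 0" using g by (intro sym_eqI) (simp add: homogeneous_def)
  then show ?thesis by (simp add: sym_rat.linear_0[OF linear_inner_sym(2)] sym_rat.linear_0[OF linear_weight])
next
  case False
  then obtain d where d: "j = int d" by (metis nonneg_int_cases not_less)
  have "g \<in> sym.span (psum ` parts_of d)" using g d by (simp add: homogeneous_in_span_psum)
  then show ?thesis
  proof (rule sym_rat.linear_eq_on[rotated 2, of g _ "\<lambda>g. inner_sym (complete_hom (int (\<Sum>\<^sub># L) - j) * g) (psum L)"])
    fix b assume "b \<in> psum ` parts_of d"
    then obtain K where K: "0 \<notin># K" "\<Sum>\<^sub># K = d" "b = psum K" by (auto simp: parts_of_def)
    have 0: "0 \<notin># L - K" using L by (meson in_diffD)
    have "inner_sym (complete_hom (int (\<Sum>\<^sub># L) - j) * b) (psum L) =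
        inner_sym (complete_hom (int (\<Sum>\<^sub># L) - j)) (skew (psum K) (psum L))"
      unfolding K(3) by (metis inner_commute inner_skew mult.commute)
    also have "\<dots> = skew_coeff K L * inner_sym (complete_hom (int (\<Sum>\<^sub># L) - j)) (psum (L - K))"
      using K(1) L by (simp add: sym_rat.linear_scale[OF linear_inner_sym(1)])
    also have "\<dots> = skew_coeff K L"
    proof (cases "K \<subseteq># L")
      case True
      then obtain M where "L = K + M" by (auto simp: subset_mset.le_iff_add)
      then show ?thesis using K d 0 by (simp add: inner_complete_hom_psum del: of_nat_sum_mset)
    qed (simp add: skew_coeff_def)
    finally show "inner_sym (complete_hom (int (\<Sum>\<^sub># L) - j) * b) (psum L) = weight L b"
      using K by simp
  qed (intro linear_weight linear_rat_compose[OF linear_inner_sym(2)] linear_sym_mult)+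
qed

interpretation minus_one: comm_ring_hom minus_one
  by standard (simp_all add: minus_one_one minus_one_mult sym_sym.linear_add[OF linear_minus_one]
      sym_sym.linear_0[OF linear_minus_one])

text \<open>
  Subtracting from each column its left neighbour, from right to left, turns the row of ones into
  \<open>(1, 0, \<dots>, 0)\<close>.
\<close>

lemma det_row_ones:
  fixes a :: "nat \<Rightarrow> nat \<Rightarrow> 'a :: comm_ring_1"
  shows "det (mat (Suc N) (Suc N) (\<lambda>(i, j). if i = 0 then 1 else a (i - 1) j)) =
    det (mat N N (\<lambda>(i, j). a i (Suc j) - a i j))"
proof -
  let ?b = "\<lambda>i j. if i = 0 then 1 else a (i - 1) j"
  let ?A = "mat (Suc N) (Suc N) (\<lambda>(i, j). ?b i j)"
  let ?C = "mat (Suc N) (Suc N) (\<lambda>(k, j). if k = j then 1 else if Suc k = j then - 1 else (0 :: 'a))"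
  let ?B = "mat (Suc N) (Suc N) (\<lambda>(i, j). if j = 0 then ?b i 0 else ?b i j - ?b i (j - 1))"
  have "?A * ?C = ?B"
  proof (rule eq_matI)
    fix i j assume "i < dim_row ?B" "j < dim_col ?B"
    then have ij: "i < Suc N" "j < Suc N" by auto
    have "(?A * ?C) $$ (i, j) = (\<Sum>k<Suc N. ?A $$ (i, k) * ?C $$ (k, j))"
      using ij by (simp add: scalar_prod_def atLeast0LessThan)
    also have "\<dots> = (\<Sum>k<Suc N. (if k = j then ?b i j else 0) - (if Suc k = j then ?b i (j - 1) else 0))"
      using ij by (intro sum.cong) auto
    also have "\<dots> = ?B $$ (i, j)"
      using ij by (cases j) (simp_all add: sum_subtractf sum.delta)
    finally show "(?A * ?C) $$ (i, j) = ?B $$ (i, j)" .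
  qed auto
  moreover have "det ?C = 1"
    by (subst det_upper_triangular[of _ "Suc N"]) (auto simp: upper_triangular_def prod_list_diag_prod)
  ultimately have "det ?A = det ?B"
    using det_mult[of ?A "Suc N" ?C] by simp
  also have "det ?B = (\<Sum>j<Suc N. ?B $$ (0, j) * cofactor ?B 0 j)"
    by (rule laplace_expansion_row) auto
  also have "\<dots> = (\<Sum>j<Suc N. if j = 0 then cofactor ?B 0 0 else 0)"
    by (intro sum.cong) auto
  also have "\<dots> = cofactor ?B 0 0" by (subst sum.delta) auto
  also have "mat_delete ?B 0 0 = mat N N (\<lambda>(i, j). a i (Suc j) - a i j)"
    by (rule eq_matI) (auto simp: mat_delete_def)
  then have "cofactor ?B 0 0 = det (mat N N (\<lambda>(i, j). a i (Suc j) - a i j))"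
    by (simp add: cofactor_def)
  finally show ?thesis .
qed

text \<open>
  As \<open>h\<^sub>m[X - 1] = h\<^sub>m - h\<^sub>m\<^sub>-\<^sub>1\<close>, the substitution turns the Jacobi-Trudi matrix into a matrix of
  column differences.  Its determinant is that of the Jacobi-Trudi matrix of \<open>(m, \<mu>)\<close> with the
  first row replaced by ones.
\<close>

lemma minus_one_schur_part:
  "minus_one (schur_part \<mu>) = (\<Sum>p | p permutes {..<Suc (length \<mu>)}.
     signof p * (\<Prod>i<length \<mu>. complete_hom (int (\<mu> ! i) + int (p (Suc i)) - int (Suc i))))"
proof -
  let ?n = "length \<mu>"
  let ?a = "\<lambda>i j. complete_hom (int (\<mu> ! i) + int j - int (Suc i))"
  let ?A = "mat (Suc ?n) (Suc ?n) (\<lambda>(i, j). if i = 0 then 1 else ?a (i - 1) j)"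
  have "map_mat minus_one (mat ?n ?n (\<lambda>(i, j). complete_hom (map int \<mu> ! i + int j - int i))) =
      mat ?n ?n (\<lambda>(i, j). ?a i (Suc j) - ?a i j)"
    by (rule eq_matI) (simp_all add: minus_one_complete_hom algebra_simps)
  then have "minus_one (schur_part \<mu>) = det (mat ?n ?n (\<lambda>(i, j). ?a i (Suc j) - ?a i j))"
    unfolding schur_def length_map minus_one.hom_det[symmetric] by (rule arg_cong)
  also have "\<dots> = det ?A" by (rule det_row_ones[symmetric])
  also have "\<dots> = (\<Sum>p | p permutes {0..<Suc ?n}. signof p * (\<Prod>i = 0..<Suc ?n. ?A $$ (i, p i)))"
    by (rule det_def') simp
  also have "\<dots> = (\<Sum>p | p permutes {0..<Suc ?n}. signof p * (\<Prod>i<?n. ?a i (p (Suc i))))"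
  proof (intro sum.cong refl arg_cong2[of _ _ _ _ "(*)"])
    fix p assume "p \<in> {p. p permutes {0..<Suc ?n}}"
    then have p: "p i < Suc ?n" if "i < Suc ?n" for i
      using permutes_in_image[of p "{0..<Suc ?n}" i] that by simp
    have "(\<Prod>i = 0..<Suc ?n. ?A $$ (i, p i)) = (\<Prod>i<Suc ?n. if i = 0 then 1 else ?a (i - 1) (p i))"
      unfolding atLeast0LessThan using p by (intro prod.cong) auto
    then show "(\<Prod>i = 0..<Suc ?n. ?A $$ (i, p i)) = (\<Prod>i<?n. ?a i (p (Suc i)))"
      by (simp only: prod.lessThan_Suc_shift) simp
  qed
  finally show ?thesis by (simp only: atLeast0LessThan)
qed

text \<open>
  The Leibniz expansion of \<open>s\<^bsub>(m, \<mu>)\<^esub>\<close> differs from that of \<open>s\<^sub>\<mu>[X - 1]\<close> only by the factor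
  \<open>h\<^bsub>m + p 0\<^esub>\<close> from the first row.  Its index is the degree of \<open>psum L\<close> minus the degree of the
  other factors, so pairing with \<open>psum L\<close> absorbs it.
\<close>

lemma inner_schur_Cons_psum:
  assumes L: "0 \<notin># L"
  shows "inner_sym (schur ((int (\<Sum>\<^sub># L) - int (sum_list \<mu>)) # map int \<mu>)) (psum L) =
    weight L (minus_one (schur_part \<mu>))"
proof -
  let ?n = "length \<mu>" and ?m = "int (\<Sum>\<^sub># L) - int (sum_list \<mu>)"
  let ?g = "\<lambda>p. \<Prod>i<?n. complete_hom (int (\<mu> ! i) + int (p (Suc i)) - int (Suc i))"
  have "schur (?m # map int \<mu>) = (\<Sum>p | p permutes {..<Suc ?n}. signof p * (complete_hom (?m + int (p 0)) * ?g p))"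
    unfolding schur_leibniz by (simp add: prod.lessThan_Suc_shift del: prod.lessThan_Suc)
  then have "inner_sym (schur (?m # map int \<mu>)) (psum L) =
      (\<Sum>p | p permutes {..<Suc ?n}. signof p * inner_sym (complete_hom (?m + int (p 0)) * ?g p) (psum L))"
    by (simp only: sym_rat.linear_sum[OF linear_inner_sym(2)] linear_rat_signof[OF linear_inner_sym(2)])
  also have "\<dots> = (\<Sum>p | p permutes {..<Suc ?n}. signof p * weight L (?g p))"
  proof (intro sum.cong refl arg_cong2[of _ _ _ _ "(*)"])
    fix p assume "p \<in> {p. p permutes {..<Suc ?n}}"
    then have p: "p permutes {..<Suc ?n}" by simp
    let ?d = "\<Sum>i<?n. int (\<mu> ! i) + int (p (Suc i)) - int (Suc i)"
    have "(\<Sum>i<Suc ?n. int (p i)) = (\<Sum>i<Suc ?n. int i)"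
      using sum.permute[OF p, of int] by (simp add: comp_def)
    then have "int (p 0) + (\<Sum>i<?n. int (p (Suc i))) = (\<Sum>i<?n. int (Suc i))"
      by (simp only: sum.lessThan_Suc_shift)
    then have "?d = int (sum_list \<mu>) - int (p 0)"
      by (simp add: sum.distrib sum_subtractf sum_list_sum_nth atLeast0LessThan)
    then have "homogeneous (int (sum_list \<mu>) - int (p 0)) (?g p)"
      using homogeneous_prod[of "{..<?n}" "\<lambda>i. int (\<mu> ! i) + int (p (Suc i)) - int (Suc i)"
          "\<lambda>i. complete_hom (int (\<mu> ! i) + int (p (Suc i)) - int (Suc i))"] homogeneous_complete_hom
      by simp
    from inner_complete_hom_mult[OF this L]
    show "inner_sym (complete_hom (?m + int (p 0)) * ?g p) (psum L) = weight L (?g p)"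
      by (simp add: algebra_simps)
  qed
  also have "\<dots> = weight L (minus_one (schur_part \<mu>))"
    unfolding minus_one_schur_part
    by (simp only: sym_rat.linear_sum[OF linear_weight] linear_rat_signof[OF linear_weight])
  finally show ?thesis .
qed

definition diagonal_op :: "sym \<Rightarrow> sym \<Rightarrow> sym" where
  "diagonal_op f = extend_sym (\<lambda>L. scale_sym (weight L f) (psum L))"

lemma linear_diagonal_op: "linear_sym (diagonal_op f)" "linear_sym (\<lambda>f. diagonal_op f g)"
  unfolding diagonal_op_def
  by (intro linear_extend_sym linear_extend_sym_param linear_sym_scale linear_weight)+

lemma diagonal_op_psum: "0 \<notin># L \<Longrightarrow> diagonal_op f (psum L) = scale_sym (weight L f) (psum L)"
  by (simp add: diagonal_op_def)

lemma Kbar_part_eq: "Kbar_part \<mu> = diagonal_op (minus_one (schur_part \<mu>))"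
proof
  fix g
  have "kron (schur ((int n - int (sum_list \<mu>)) # map int \<mu>)) (hom_component n g) =
      diagonal_op (minus_one (schur_part \<mu>)) (hom_component n g)" for n
    by (rule sym_sym.linear_eq_on[OF linear_kron(1) linear_diagonal_op(1)
          homogeneous_in_span_psum[OF homogeneous_hom_component]])
      (auto simp: parts_of_def kron_psum diagonal_op_psum inner_schur_Cons_psum simp del: of_nat_sum_mset)
  then have "Kbar_part \<mu> g =
      (\<Sum>n | hom_component n g \<noteq> 0. diagonal_op (minus_one (schur_part \<mu>)) (hom_component n g))"
    by (simp add: Kbar_part_def kronecker_eq)
  also have "\<dots> = diagonal_op (minus_one (schur_part \<mu>)) g"
    by (simp only: sym_sym.linear_sum[OF linear_diagonal_op(1), symmetric] sum_hom_components)
  finally show "Kbar_part \<mu> g = diagonal_op (minus_one (schur_part \<mu>)) g" .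
qed

lemma Kbar_eq: "Kbar = (\<lambda>f. diagonal_op (minus_one f))"
  unfolding Kbar_def
proof (rule the_equality, intro conjI allI impI)
  show lin: "linear_sym (\<lambda>f. diagonal_op (minus_one f) g)" for g
    by (rule linear_sym_compose[OF linear_diagonal_op(2) linear_minus_one])
  fix K
  assume K: "(\<forall>g. linear_sym (\<lambda>f. K f g)) \<and> (\<forall>\<mu>. is_partition \<mu> \<longrightarrow> K (schur_part \<mu>) = Kbar_part \<mu>)"
  show "K = (\<lambda>f. diagonal_op (minus_one f))"
  proof (intro ext)
    fix f g
    show "K f g = diagonal_op (minus_one f) g"
      by (rule linear_sym_schur_eqI[OF _ lin]) (use K in \<open>auto simp: Kbar_part_eq\<close>)
  qed
qed (simp add: Kbar_part_eq)

lemma UD_term_eq: "UD_term f \<mu> g = kron (minus_one f) (schur_part \<mu>) * skew (schur_part \<mu>) g"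
  by (simp add: UD_term_def U_op_def D_op_eq kronecker_eq subst_minus_one_eq)

text \<open>
  For a product of power sums, \<open>kron\<close> reduces the coefficients \<open>f * s\<^sub>\<mu>\<close> to the numbers
  \<open>\<langle>f, s\<^sub>\<mu>\<rangle>\<close> times \<open>f\<close>; orthonormality of the Schur functions then collapses the sum to \<open>U\<^sub>f D\<^sub>f\<close>,
  which is diagonal because \<open>D\<^sub>f\<close> removes the factors that \<open>U\<^sub>f\<close> puts back.
\<close>

lemma sum_UD_psum:
  assumes K: "0 \<notin># K" and A: "finite A" "A \<subseteq> {\<mu>. is_partition \<mu>}" "partitions_of (\<Sum>\<^sub># K) \<subseteq> A"
  shows "(\<Sum>\<mu>\<in>A. kron (psum K) (schur_part \<mu>) * skew (schur_part \<mu>) g) = diagonal_op (psum K) g"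
proof -
  have "kron (psum K) (schur_part \<mu>) = scale_sym (inner_sym (psum K) (schur_part \<mu>)) (psum K)" for \<mu>
    using K by (simp add: kron_commute[of "psum K"] kron_psum inner_commute[of "psum K"])
  then have "(\<Sum>\<mu>\<in>A. kron (psum K) (schur_part \<mu>) * skew (schur_part \<mu>) g) =
      psum K * skew (\<Sum>\<mu>\<in>A. scale_sym (inner_sym (psum K) (schur_part \<mu>)) (schur_part \<mu>)) g"
    by (simp add: sym_sym.linear_sum[OF linear_skew(2)] sym_sym.linear_scale[OF linear_skew(2)]
        scale_sym_mult_left scale_sym_mult_right sum_distrib_left)
  also have "\<dots> = psum K * skew (psum K) g"
    by (simp only: psum_schur_expansion[OF K A, symmetric])
  also have "\<dots> = diagonal_op (psum K) g"
  proof (rule linear_sym_eqI[of "\<lambda>g. psum K * skew (psum K) g"])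
    fix L :: "nat multiset" assume L: "0 \<notin># L"
    show "psum K * skew (psum K) (psum L) = diagonal_op (psum K) (psum L)"
      using K L by (cases "K \<subseteq># L")
        (simp_all add: diagonal_op_psum scale_sym_mult_right skew_coeff_def flip: psum_union)
  qed (intro linear_sym_compose[OF linear_sym_mult(1)] linear_skew linear_diagonal_op)+
  finally show ?thesis .
qed

lemma kron_psum_schur_part_eq_0:
  assumes "0 \<notin># K" "sum_list \<mu> \<noteq> \<Sum>\<^sub># K"
  shows "kron (psum K) (schur_part \<mu>) = 0"
  using assms inner_homogeneous_psum[OF homogeneous_schur_part, of K \<mu>]
  by (simp add: kron_commute[of "psum K"] kron_psum)

text \<open>
  A general \<open>f\<close> is handled by expanding \<open>f[X - 1]\<close> in products of power sums.  Only partitions of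
  the finitely many degrees that occur give nonzero terms.
\<close>

lemma finite_sum_UD_terms:
  "finite {\<mu>. is_partition \<mu> \<and> UD_term f \<mu> \<noteq> (\<lambda>_. 0)}" (is "finite ?A")
  "(\<Sum>\<mu> | is_partition \<mu> \<and> UD_term f \<mu> \<noteq> (\<lambda>_. 0). UD_term f \<mu> g) = diagonal_op (minus_one f) g"
proof -
  obtain S a where S: "finite S" "S \<subseteq> {K. 0 \<notin># K}" "minus_one f = (\<Sum>K\<in>S. scale_sym (a K) (psum K))"
    using psum_expansion by blast
  let ?B = "\<Union>K\<in>S. partitions_of (\<Sum>\<^sub># K)"
  have B: "finite ?B" "?B \<subseteq> {\<mu>. is_partition \<mu>}"
    using S(1) finite_partitions_of by (auto simp: partitions_of_def)
  have kron_f: "kron (minus_one f) s = (\<Sum>K\<in>S. scale_sym (a K) (kron (psum K) s))" for s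
    by (simp add: S(3) sym_sym.linear_sum[OF linear_kron(2)] sym_sym.linear_scale[OF linear_kron(2)])
  have "kron (minus_one f) (schur_part \<mu>) = 0" if "is_partition \<mu>" "\<mu> \<notin> ?B" for \<mu>
  proof -
    have "kron (psum K) (schur_part \<mu>) = 0" if "K \<in> S" for K
      using that \<open>is_partition \<mu>\<close> \<open>\<mu> \<notin> ?B\<close> S(2)
      by (intro kron_psum_schur_part_eq_0) (auto simp: partitions_of_def)
    then show ?thesis by (simp add: kron_f)
  qed
  then have "UD_term f \<mu> = (\<lambda>_. 0)" if "is_partition \<mu>" "\<mu> \<notin> ?B" for \<mu>
    using that by (simp add: UD_term_eq fun_eq_iff)
  then have sub: "?A \<subseteq> ?B" by blast
  then show "finite ?A" using B(1) by (rule finite_subset)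
  have "(\<Sum>\<mu>\<in>?A. UD_term f \<mu> g) = (\<Sum>\<mu>\<in>?B. UD_term f \<mu> g)"
    using sub B by (intro sum.mono_neutral_left) auto
  also have "\<dots> = (\<Sum>\<mu>\<in>?B. \<Sum>K\<in>S. scale_sym (a K) (kron (psum K) (schur_part \<mu>) * skew (schur_part \<mu>) g))"
    by (simp add: UD_term_eq kron_f sum_distrib_right scale_sym_mult_left)
  also have "\<dots> = (\<Sum>K\<in>S. scale_sym (a K) (\<Sum>\<mu>\<in>?B. kron (psum K) (schur_part \<mu>) * skew (schur_part \<mu>) g))"
    by (subst sum.swap) (simp add: sym.scale_sum_right)
  also have "\<dots> = (\<Sum>K\<in>S. scale_sym (a K) (diagonal_op (psum K) g))"
    using S(2) B by (intro sum.cong refl arg_cong[of _ _ "scale_sym _"] sum_UD_psum) auto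
  also have "\<dots> = diagonal_op (minus_one f) g"
    by (simp add: S(3) sym_sym.linear_sum[OF linear_diagonal_op(2)] sym_sym.linear_scale[OF linear_diagonal_op(2)])
  finally show "(\<Sum>\<mu>\<in>?A. UD_term f \<mu> g) = diagonal_op (minus_one f) g" .
qed

lemma op_subalgebra_sum:
  "finite A \<Longrightarrow> (\<And>i. i \<in> A \<Longrightarrow> T i \<in> op_subalgebra G) \<Longrightarrow> (\<lambda>g. \<Sum>i\<in>A. T i g) \<in> op_subalgebra G"
proof (induction A rule: finite_induct)
  case empty
  show ?case using op_subalgebra.scale[OF op_subalgebra.ident, of 0 G] by simp
next
  case (insert i A)
  then show ?case using op_subalgebra.add[of "T i" G "\<lambda>g. \<Sum>i\<in>A. T i g"] by simp
qed

lemma UD_term_in_op_subalgebra: "UD_term f \<mu> \<in> op_subalgebra (range U_op \<union> range D_op)"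
  unfolding UD_term_def by (intro op_subalgebra.comp op_subalgebra.gen) auto

theorem proposition4p5:
  fixes f :: sym
  shows "Kbar f \<in> op_subalgebra (range U_op \<union> range D_op) \<and>
         finite {\<mu>. is_partition \<mu> \<and> UD_term f \<mu> \<noteq> (\<lambda>_. 0)} \<and>
         Kbar f = (\<lambda>g. \<Sum>\<mu> | is_partition \<mu> \<and> UD_term f \<mu> \<noteq> (\<lambda>_. 0). UD_term f \<mu> g)"
proof (intro conjI)
  show eq: "Kbar f = (\<lambda>g. \<Sum>\<mu> | is_partition \<mu> \<and> UD_term f \<mu> \<noteq> (\<lambda>_. 0). UD_term f \<mu> g)"
    by (simp only: Kbar_eq finite_sum_UD_terms(2))
  show "Kbar f \<in> op_subalgebra (range U_op \<union> range D_op)"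
    unfolding eq by (intro op_subalgebra_sum finite_sum_UD_terms(1) UD_term_in_op_subalgebra)
qed (rule finite_sum_UD_terms(1))

end
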